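(* For any initial state $\mathcal{S}_0$ of the rotor-router system with $k$ tokens on a connected graph $G$ with $m$ edges and diameter $D$, there exists $T=\mathcal{O}(m^4D^2+mD\log k)$ such that $\mathcal{S}_T$ is stable.
   Context: Rotor-router model: $G=(V,E)$ is a finite connected undirected graph with $m$ edges and diameter $D$; its arcs are the ordered pairs $(u,v)$ with $\{u,v\}\in E$. Each vertex $v$ has a fixed cyclic ordering $\rho_v$ of its outgoing arcs, with $\mathit{next}(e)$ the successor of $e$ in $\rho_v$. A state $\mathcal{S}_t$ consists of a pointer $\mathit{pointer}_v$ (an outgoing arc of $v$) and a number of identical tokens at each vertex $v$; $k$ is the total number of tokens. In each synchronous step every vertex $v$, while it has tokens, sends one token along $\mathit{pointer}_v$ and sets $\mathit{pointer}_v:=\mathit{next}(\mathit{pointer}_v)$; tokens sent at step $t$ are at the heads of their arcs at time $t+1$. $\mathcal{S}_t$ is stable if $\mathcal{S}_{t'}=\mathcal{S}_t$ for some $t'>t$. The constant in $\mathcal{O}$ is absolute. *)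

theory Defs
  imports Complex_Main "Graph_Theory.Graph_Theory" "HOL-Combinatorics.Orbits"
begin

text \<open>
  Finite simple undirected graphs are represented by the symmetric digraphs
  \<^locale>\<open>pair_graph\<close>, in which every edge \<open>{u, v}\<close> occurs as the two arcs
  \<open>(u, v)\<close> and \<open>(v, u)\<close>.
\<close>

definition edges :: "'a pair_pre_digraph \<Rightarrow> 'a set set" where
  "edges G = (\<lambda>(u, v). {u, v}) ` parcs G"

definition graph_dist :: "'a pair_pre_digraph \<Rightarrow> 'a \<Rightarrow> 'a \<Rightarrow> nat" where
  "graph_dist G u v =
    (LEAST n. \<exists>p. pre_digraph.awalk (with_proj G) u p v \<and> length p = n)"

definition diameter :: "'a pair_pre_digraph \<Rightarrow> nat" where
  "diameter G = Max ((\<lambda>(u, v). graph_dist G u v) ` (pverts G \<times> pverts G))"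

text \<open>
  The cyclic orderings \<open>\<rho>\<^sub>v\<close> are given by their common successor function on
  arcs, which permutes the outgoing arcs of each vertex in a single cycle. Since
  \<^const>\<open>cyclic_on\<close> requires a nonempty set, graphs without arcs are excluded;
  these admit no pointers.
\<close>

definition rotor :: "'a pair_pre_digraph \<Rightarrow> ('a \<times> 'a \<Rightarrow> 'a \<times> 'a) \<Rightarrow> bool" where
  "rotor G nxt \<longleftrightarrow> (\<forall>v \<in> pverts G. cyclic_on nxt (out_arcs (with_proj G) v))"

record 'a rr_state =
  pointer :: "'a \<Rightarrow> 'a \<times> 'a"
  tokens :: "'a \<Rightarrow> nat"

definition rr_state_on :: "'a pair_pre_digraph \<Rightarrow> 'a rr_state \<Rightarrow> bool" where
  "rr_state_on G S \<longleftrightarrow>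
    (\<forall>v \<in> pverts G. pointer S v \<in> out_arcs (with_proj G) v) \<and>
    (\<forall>v. v \<notin> pverts G \<longrightarrow> tokens S v = 0)"

definition num_tokens :: "'a pair_pre_digraph \<Rightarrow> 'a rr_state \<Rightarrow> nat" where
  "num_tokens G S = (\<Sum>v \<in> pverts G. tokens S v)"

text \<open>
  Within one step, a vertex \<open>v\<close> holding \<open>c\<close> tokens sends its \<open>i\<close>-th token
  (\<open>i = 0, \<dots>, c - 1\<close>) along the arc \<open>(nxt ^^ i) (pointer S v)\<close>, the position
  of its pointer after \<open>i\<close> advances. Outside \<open>pverts G\<close> there are no tokens, so
  the pointers there, which are arbitrary, never change and do not affect equality
  of states along a run.
\<close>

definition rr_step ::
  "'a pair_pre_digraph \<Rightarrow> ('a \<times> 'a \<Rightarrow> 'a \<times> 'a) \<Rightarrow> 'a rr_state \<Rightarrow> 'a rr_state" where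
  "rr_step G nxt S =
    \<lparr> pointer = (\<lambda>v. (nxt ^^ tokens S v) (pointer S v)),
      tokens = (\<lambda>u. \<Sum>v \<in> pverts G.
        card {i. i < tokens S v \<and> snd ((nxt ^^ i) (pointer S v)) = u}) \<rparr>"

definition rr_run ::
  "'a pair_pre_digraph \<Rightarrow> ('a \<times> 'a \<Rightarrow> 'a \<times> 'a) \<Rightarrow> 'a rr_state \<Rightarrow> nat \<Rightarrow> 'a rr_state" where
  "rr_run G nxt S\<^sub>0 t = (rr_step G nxt ^^ t) S\<^sub>0"

definition stable_at ::
  "'a pair_pre_digraph \<Rightarrow> ('a \<times> 'a \<Rightarrow> 'a \<times> 'a) \<Rightarrow> 'a rr_state \<Rightarrow> nat \<Rightarrow> bool" where
  "stable_at G nxt S\<^sub>0 t \<longleftrightarrow> (\<exists>t' > t. rr_run G nxt S\<^sub>0 t' = rr_run G nxt S\<^sub>0 t)"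

end

theory Submission
  imports Defs
begin

text \<open>
  Let \<open>W s i e\<close> be the number of tokens sent along the arc \<open>e\<close> during the \<open>i\<close> steps starting at
  time \<open>s\<close>, and let \<open>\<Phi> i s\<close> be the sum of the squares of these loads. A rotor distributes whatever
  enters its vertex as evenly as possible, so \<open>\<Phi> i\<close> never increases, and it stays constant in a
  step only if the loads of the arcs entering any vertex differ by at most 1.

  While the loads spread over more than \<open>9 D\<close>, the excess of \<open>\<Phi> i\<close> over its later values shrinks by
  a factor \<open>1 - 1 / (11 a D)\<close> per step, where \<open>a \<le> 2 m\<close> is the number of arcs. Hence after
  \<open>O(m D log (i k))\<close> steps the excess is at most \<open>81 a D\<^sup>2\<close>. Applied to all \<open>i \<le> 2 a + 1\<close>, this
  leaves only \<open>O(m\<^sup>2 D\<^sup>2)\<close> further drops, so one of the next \<open>O(m\<^sup>2 D\<^sup>2)\<close> blocks of \<open>O(m\<^sup>2)\<close> steps is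
  free of drops.

  In such a block the arcs entering a vertex can be sorted so that, one step later, the arcs leaving
  it in rotor order repeat their loads. This matching permutes the arcs, each arc returns after at
  most \<open>a\<close> steps, and a block longer than twice the product of two such periods suffices to show that
  the matching persists forever. Then all loads are periodic and the configuration recurs.
\<close>

section \<open>Balanced integer families\<close>

text \<open>With \<open>a\<close> the minimum of \<open>g\<close>, the quadratic
  \<open>q t = (t - a) * (t - a - 1)\<close> is nonnegative on the integers and vanishes at
  \<open>a\<close> and \<open>a + 1\<close>, the only possible values of \<open>g\<close>. Since
  sums and cardinalities agree, the drop in squares is the sum of \<open>q\<close> over the values
  of \<open>f\<close>.\<close>

lemma balanced_sum_squares_drop:
  fixes f :: "'a \<Rightarrow> int" and g :: "'b \<Rightarrow> int"
  assumes fin: "finite X" "finite Y" and card: "card X = card Y" and sum: "sum f X = sum g Y"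
    and bal: "\<And>y y'. y \<in> Y \<Longrightarrow> y' \<in> Y \<Longrightarrow> g y \<le> g y' + 1"
    and x: "x1 \<in> X" "x2 \<in> X"
  shows "(f x1 - f x2)\<^sup>2 - 1 \<le> 2 * ((\<Sum>x\<in>X. (f x)\<^sup>2) - (\<Sum>y\<in>Y. (g y)\<^sup>2))"
proof -
  have "Y \<noteq> {}" using card x fin by auto
  define a where "a = Min (g ` Y)"
  have "a \<in> g ` Y" unfolding a_def using fin \<open>Y \<noteq> {}\<close> by (intro Min_in) auto
  then have ga: "g y = a \<or> g y = a + 1" if "y \<in> Y" for y
  proof -
    have "a \<le> g y" unfolding a_def using that fin by (intro Min_le) auto
    moreover have "g y \<le> a + 1" using \<open>a \<in> g ` Y\<close> bal[OF that] by auto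
    ultimately show ?thesis by auto
  qed
  define q where "q t = (t - a) * (t - a - 1)" for t :: int
  have q_nonneg: "q t \<ge> 0" for t
    unfolding q_def by (cases "t - a \<ge> 1") (auto intro: mult_nonneg_nonneg mult_nonpos_nonpos)
  have q_alt: "q t = t\<^sup>2 - (2*a+1) * t + a * (a + 1)" for t
    unfolding q_def by (simp add: power2_eq_square algebra_simps)
  have "(\<Sum>y\<in>Y. q (g y)) = 0" using ga by (intro sum.neutral) (force simp: q_def)
  then have Yq: "(\<Sum>y\<in>Y. (g y)\<^sup>2) = (2*a+1) * sum g Y - int (card Y) * (a*(a+1))"
    by (simp add: q_alt sum.distrib sum_subtractf sum_distrib_left)
  have Xq: "(\<Sum>x\<in>X. q (f x)) = (\<Sum>x\<in>X. (f x)\<^sup>2) - (\<Sum>y\<in>Y. (g y)\<^sup>2)"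
    unfolding Yq sum[symmetric]
    by (simp add: q_alt sum.distrib sum_subtractf sum_distrib_left card)
  have le: "(f x1 - f x2)\<^sup>2 - 1 \<le> 2 * (\<Sum>x\<in>X. q (f x))"
  proof (cases "x1 = x2")
    case True
    then show ?thesis using sum_nonneg[of X "\<lambda>x. q (f x)"] q_nonneg by simp
  next
    case False
    have "q (f x1) + q (f x2) = (\<Sum>x\<in>{x1,x2}. q (f x))" using False by simp
    also have "\<dots> \<le> (\<Sum>x\<in>X. q (f x))"
      using x fin q_nonneg by (intro sum_mono2) auto
    finally have "2 * (q (f x1) + q (f x2)) \<le> 2 * (\<Sum>x\<in>X. q (f x))" by simp
    \<comment> \<open>In terms of \<open>t - a - 1/2\<close> this is the parallelogram law; dropping
      the square on the right leaves a bound in the difference of the two values alone.\<close>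
    moreover have "2 * (q (f x1) + q (f x2)) - ((f x1 - f x2)\<^sup>2 - 1) = (f x1 + f x2 - 2*a - 1)\<^sup>2"
      unfolding q_def by (simp add: power2_eq_square algebra_simps)
    ultimately show ?thesis
      using zero_le_power2[of "f x1 + f x2 - 2*a - 1"] by linarith
  qed
  show ?thesis using le unfolding Xq .
qed

text \<open>Two such sequences cannot cross, for then one of them would fall by at least 2. Hence
  one dominates the other, and equal sums force equality.\<close>

lemma balanced_descending_unique:
  fixes a b :: "nat \<Rightarrow> int"
  assumes a: "\<And>j j'. j < j' \<Longrightarrow> j' < d \<Longrightarrow> a j' \<le> a j \<and> a j \<le> a j' + 1"
    and b: "\<And>j j'. j < j' \<Longrightarrow> j' < d \<Longrightarrow> b j' \<le> b j \<and> b j \<le> b j' + 1"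
    and sum: "(\<Sum>j<d. a j) = (\<Sum>j<d. b j)" and "j < d"
  shows "a j = b j"
proof -
  have no_cross: False if "j < d" "l < d" "a j < b j" "b l < a l" for j l
    using a[of j l] b[of j l] a[of l j] b[of l j] that by (cases j l rule: linorder_cases) auto
  have le_eq: "f j = g j" if "\<And>j. j < d \<Longrightarrow> f j \<le> g j" "(\<Sum>j<d. f j) = (\<Sum>j<d. g j)" "j < d"
    for f g :: "nat \<Rightarrow> int" and j
    using sum_mono_inv[of f "{..<d}" g j] that by auto
  show ?thesis
  proof (cases "\<exists>l<d. a l < b l")
    case True
    then have "\<And>l. l < d \<Longrightarrow> a l \<le> b l" using no_cross by force
    then show ?thesis using le_eq[of a b j] sum \<open>j < d\<close> by auto
  next
    case False
    then have "\<And>l. l < d \<Longrightarrow> b l \<le> a l" by force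
    then show ?thesis using le_eq[of b a j] sum \<open>j < d\<close> by auto
  qed
qed

lemma ex_descending_enumeration:
  fixes key :: "'a \<Rightarrow> int"
  assumes "finite X"
  shows "\<exists>g. bij_betw g {..<card X} X \<and> (\<forall>j j'. j < j' \<longrightarrow> j' < card X \<longrightarrow> key (g j') \<le> key (g j))"
proof -
  obtain xs where xs: "set xs = X" "distinct xs" using finite_distinct_list[OF assms] by blast
  define ys where "ys = sort_key (\<lambda>x. - key x) xs"
  have ys: "set ys = X" "distinct ys" "sorted (map (\<lambda>x. - key x) ys)"
    unfolding ys_def using xs by auto
  have len: "length ys = card X" using ys distinct_card by fastforce
  have "bij_betw ((!) ys) {..<card X} X" using bij_betw_nth[OF ys(2)] ys(1) len by auto
  moreover have "key (ys ! j') \<le> key (ys ! j)" if "j < j'" "j' < card X" for j j'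
    using sorted_nth_mono[OF ys(3), of j j'] that len by auto
  ultimately show ?thesis by blast
qed

text \<open>Cauchy-Schwarz against the constant 1, read off from the double sum of all squared
  differences.\<close>

lemma sum_squared_le_card_mult_sum_squares:
  fixes f :: "'a \<Rightarrow> real"
  shows "(\<Sum>j\<in>J. f j)\<^sup>2 \<le> of_nat (card J) * (\<Sum>j\<in>J. (f j)\<^sup>2)"
proof -
  have "0 \<le> (\<Sum>i\<in>J. \<Sum>j\<in>J. (f i - f j)\<^sup>2)" by (intro sum_nonneg) auto
  also have "\<dots> = (\<Sum>i\<in>J. \<Sum>j\<in>J. (f i)\<^sup>2 + (f j)\<^sup>2 - 2 * (f i * f j))"
    by (simp add: power2_eq_square algebra_simps)
  also have "\<dots> = 2 * (of_nat (card J) * (\<Sum>j\<in>J. (f j)\<^sup>2)) - 2 * (\<Sum>i\<in>J. \<Sum>j\<in>J. f i * f j)"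
    by (simp add: sum.distrib sum_subtractf sum_distrib_left)
  also have "(\<Sum>i\<in>J. \<Sum>j\<in>J. f i * f j) = (\<Sum>j\<in>J. f j)\<^sup>2"
    by (simp add: power2_eq_square sum_product)
  finally show ?thesis by simp
qed

section \<open>Loads and their energy\<close>

text \<open>The decay and periodicity arguments see a run only through \<open>x t e\<close>, the
  number of tokens sent along \<open>e\<close> at time \<open>t\<close>. In
  \<open>round_robin\<close> the enumeration \<open>f\<close> is the rotor order from time
  \<open>s\<close> on; it is chosen before \<open>i\<close>, so one order serves all windows
  starting at \<open>s\<close>.\<close>

locale token_loads =
  fixes V :: "'a set" and A :: "('a \<times> 'a) set" and D k :: nat and x :: "nat \<Rightarrow> 'a \<times> 'a \<Rightarrow> int"
  assumes fin_V: "finite V" and A_V: "A \<subseteq> V \<times> V" and sym_A: "sym A" and D_pos: "0 < D"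
    and dist_le: "u \<in> V \<Longrightarrow> v \<in> V \<Longrightarrow> \<exists>n\<le>D. (u, v) \<in> A ^^ n"
    and load_nonneg: "0 \<le> x t e"
    and conservation: "v \<in> V \<Longrightarrow>
      (\<Sum>e | e \<in> A \<and> fst e = v. x (Suc t) e) = (\<Sum>e | e \<in> A \<and> snd e = v. x t e)"
    and round_robin: "v \<in> V \<Longrightarrow> \<exists>f. bij_betw f {..<card {e \<in> A. fst e = v}} {e \<in> A. fst e = v} \<and>
      (\<forall>i j j'. j < j' \<longrightarrow> j' < card {e \<in> A. fst e = v} \<longrightarrow>
        (\<Sum>q<i. x (s + q) (f j')) \<le> (\<Sum>q<i. x (s + q) (f j)) \<and>
        (\<Sum>q<i. x (s + q) (f j)) \<le> (\<Sum>q<i. x (s + q) (f j')) + 1)"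
    and total_load: "(\<Sum>e\<in>A. x t e) = int k"
begin

definition out :: "'a \<Rightarrow> ('a \<times> 'a) set" where "out v = {e \<in> A. fst e = v}"
definition inn :: "'a \<Rightarrow> ('a \<times> 'a) set" where "inn v = {e \<in> A. snd e = v}"
definition W :: "nat \<Rightarrow> nat \<Rightarrow> 'a \<times> 'a \<Rightarrow> int" where "W s i e = (\<Sum>q<i. x (s + q) e)"
definition \<Phi> :: "nat \<Rightarrow> nat \<Rightarrow> int" where "\<Phi> i s = (\<Sum>e\<in>A. (W s i e)\<^sup>2)"
text \<open>The second window starts one step later because what enters \<open>v\<close> in one step
  leaves it in the next.\<close>

definition energy_drop :: "nat \<Rightarrow> nat \<Rightarrow> 'a \<Rightarrow> int" where
  "energy_drop s i v = (\<Sum>e\<in>inn v. (W s i e)\<^sup>2) - (\<Sum>e\<in>out v. (W (Suc s) i e)\<^sup>2)"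

lemma fin_A: "finite A" using A_V fin_V finite_subset by blast
lemma fin_out [simp]: "finite (out v)" and fin_inn [simp]: "finite (inn v)"
  using fin_A by (auto simp: out_def inn_def)

lemma card_inn: "card (inn v) = card (out v)"
proof -
  have "bij_betw prod.swap (inn v) (out v)"
    using sym_A by (intro bij_betw_byWitness[of _ prod.swap]) (auto simp: inn_def out_def sym_def)
  then show ?thesis by (rule bij_betw_same_card)
qed

lemma W_0 [simp]: "W s 0 e = 0" by (simp add: W_def)
lemma W_Suc: "W s (Suc i) e = W s i e + x (s + i) e" by (simp add: W_def)
lemma W_add: "W s (i + j) e = W s i e + W (s + i) j e"
  by (induction j) (simp_all add: W_Suc add.assoc del: One_nat_def)
lemma W_nonneg: "0 \<le> W s i e" by (simp add: W_def sum_nonneg load_nonneg)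

lemma W_conservation:
  assumes "v \<in> V" shows "(\<Sum>e\<in>out v. W (Suc s) i e) = (\<Sum>e\<in>inn v. W s i e)"
  using conservation[OF assms] unfolding W_def out_def inn_def
  by (subst (1 2) sum.swap) simp

lemma ex_rotor_enumeration:
  assumes "v \<in> V"
  shows "\<exists>f. bij_betw f {..<card (out v)} (out v) \<and>
      (\<forall>i j j'. j < j' \<longrightarrow> j' < card (out v) \<longrightarrow> W s i (f j') \<le> W s i (f j) \<and> W s i (f j) \<le> W s i (f j') + 1)"
  using round_robin[OF assms, of s] unfolding W_def out_def .

lemma W_out_balanced:
  assumes "v \<in> V" "e \<in> out v" "e' \<in> out v" shows "W s i e \<le> W s i e' + 1"
proof -
  obtain f where f: "bij_betw f {..<card (out v)} (out v)"
    "\<And>j j'. j < j' \<Longrightarrow> j' < card (out v) \<Longrightarrow> W s i (f j') \<le> W s i (f j) \<and> W s i (f j) \<le> W s i (f j') + 1"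
    using ex_rotor_enumeration[OF assms(1), of s] by blast
  obtain j j' where "e = f j" "e' = f j'" "j < card (out v)" "j' < card (out v)"
    using assms f(1) unfolding bij_betw_def by blast
  then show ?thesis using f(2)[of j j'] f(2)[of j' j] by (cases j j' rule: linorder_cases) auto
qed

lemma W_total: "(\<Sum>e\<in>A. W s i e) = int (i * k)"
  unfolding W_def by (subst sum.swap) (simp add: total_load)

lemma sum_out: "(\<Sum>v\<in>V. \<Sum>e\<in>out v. f e) = (\<Sum>e\<in>A. f e)"
  unfolding out_def using fin_A fin_V A_V by (intro sum.group) auto
lemma sum_inn: "(\<Sum>v\<in>V. \<Sum>e\<in>inn v. f e) = (\<Sum>e\<in>A. f e)"
  unfolding inn_def using fin_A fin_V A_V by (intro sum.group) auto

lemma energy_drop_ge: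
  assumes "v \<in> V" "e1 \<in> inn v" "e2 \<in> inn v"
  shows "(W s i e1 - W s i e2)\<^sup>2 - 1 \<le> 2 * energy_drop s i v"
  unfolding energy_drop_def
  by (rule balanced_sum_squares_drop)
     (use assms W_conservation card_inn W_out_balanced in auto)

lemma energy_drop_nonneg: "v \<in> V \<Longrightarrow> 0 \<le> energy_drop s i v"
proof (cases "inn v = {}")
  case True
  then have "out v = {}" using card_inn[of v] by simp
  with True show ?thesis by (simp add: energy_drop_def)
next
  case False
  then obtain e where "e \<in> inn v" by blast
  moreover assume "v \<in> V"
  ultimately show ?thesis using energy_drop_ge[of v e e s i] by simp
qed

lemma \<Phi>_diff: "\<Phi> i s - \<Phi> i (Suc s) = (\<Sum>v\<in>V. energy_drop s i v)"
  by (simp add: \<Phi>_def energy_drop_def sum_subtractf sum_inn sum_out)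

lemma \<Phi>_Suc_le: "\<Phi> i (Suc s) \<le> \<Phi> i s"
  using \<Phi>_diff[of i s] sum_nonneg[of V "energy_drop s i"] energy_drop_nonneg by auto

lemma \<Phi>_antimono: "s \<le> t \<Longrightarrow> \<Phi> i t \<le> \<Phi> i s"
  using lift_Suc_antimono_le[of "\<Phi> i"] \<Phi>_Suc_le by blast

lemma \<Phi>_nonneg: "0 \<le> \<Phi> i s" unfolding \<Phi>_def by (intro sum_nonneg) auto

text \<open>The local drops are nonnegative and add up to the global one, so each of them vanishes,
  and \<open>energy_drop_ge\<close> leaves a difference of at most 1.\<close>

lemma inn_balanced_if_\<Phi>_eq:
  assumes "\<Phi> i (Suc s) = \<Phi> i s" "v \<in> V" "e \<in> inn v" "e' \<in> inn v"
  shows "W s i e \<le> W s i e' + 1"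
proof -
  have "(\<Sum>v\<in>V. energy_drop s i v) = 0" using \<Phi>_diff[of i s] assms by simp
  then have "energy_drop s i v = 0" using sum_nonneg_eq_0_iff[OF fin_V, of "energy_drop s i"] energy_drop_nonneg assms(2) by blast
  then have "(W s i e - W s i e')\<^sup>2 \<le> 1\<^sup>2" using energy_drop_ge[OF assms(2-4), of s i] by simp
  then show ?thesis using abs_le_square_iff[of "W s i e - W s i e'" 1] by simp
qed

text \<open>For nonnegative loads the sum of squares is at most the square of the sum. This is the
  starting value of the exponential decay.\<close>

lemma \<Phi>_le: "\<Phi> i s \<le> (int (i * k))\<^sup>2"
proof -
  have "(\<Sum>e\<in>A. (W s i e)\<^sup>2) \<le> (\<Sum>e\<in>A. W s i e * int (i * k))"
  proof (intro sum_mono)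
    fix e assume "e \<in> A"
    then have "W s i e \<le> int (i * k)"
      using member_le_sum[of e A "W s i"] fin_A W_nonneg W_total by simp
    then show "(W s i e)\<^sup>2 \<le> W s i e * int (i * k)"
      unfolding power2_eq_square using W_nonneg by (intro mult_left_mono)
  qed
  also have "\<dots> = (int (i * k))\<^sup>2" by (simp only: sum_distrib_right[symmetric] W_total power2_eq_square)
  finally show ?thesis by (simp add: \<Phi>_def)
qed

section \<open>Decay of the energy\<close>

text \<open>Loads spread out only among vertices joined by walks of even length: in a bipartite graph the
  tokens on the two sides never mix.\<close>

definition class_rel :: "('a \<times> 'a) set" where "class_rel = (A O A)\<^sup>*"

section \<open>Walks of even length and two-step paths\<close>

lemma relpow_A_sym: "(u, v) \<in> A ^^ n \<Longrightarrow> (v, u) \<in> A ^^ n"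
proof (induction n arbitrary: v)
  case (Suc n)
  then obtain w where "(u, w) \<in> A ^^ n" "(v, w) \<in> A" using sym_A by (auto dest: symD)
  then show ?case using Suc.IH by (intro relpow_Suc_I2)
qed simp

lemma class_rel_sym: "(u, v) \<in> class_rel \<Longrightarrow> (v, u) \<in> class_rel"
proof -
  have "sym (A O A)" using sym_A unfolding sym_def by blast
  then show "(u, v) \<in> class_rel \<Longrightarrow> (v, u) \<in> class_rel"
    unfolding class_rel_def using sym_rtrancl symD by metis
qed

lemma class_rel_trans: "(u, v) \<in> class_rel \<Longrightarrow> (v, w) \<in> class_rel \<Longrightarrow> (u, w) \<in> class_rel"
  unfolding class_rel_def by (rule rtrancl_trans)

lemma two_step_relpow: "(A O A) ^^ r = A ^^ (2 * r)"
  by (induction r) (simp_all add: O_assoc)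

text \<open>Follow the given walk and compare it at each vertex with a walk from \<open>u\<close> of
  length at most \<open>D\<close>. The first time the parities disagree, the short walk to
  \<open>y\<close>, the arc to \<open>z\<close> and the short walk back to \<open>u\<close> close up
  to an odd walk.\<close>

lemma short_even_walk_or_odd_cycle:
  assumes "u \<in> V" "(u, z) \<in> A ^^ n"
  shows "(\<exists>d\<le>D. (u, z) \<in> A ^^ d \<and> even (d + n)) \<or> (\<exists>c\<le>2 * D + 1. odd c \<and> (u, u) \<in> A ^^ c)"
  using assms(2)
proof (induction n arbitrary: z)
  case 0
  then show ?case by (auto intro!: exI[of _ 0])
next
  case (Suc n)
  then obtain y where y: "(u, y) \<in> A ^^ n" "(y, z) \<in> A" by auto
  then have "z \<in> V" using A_V by auto
  then obtain d' where d': "d' \<le> D" "(u, z) \<in> A ^^ d'" using dist_le assms(1) by blast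
  from Suc.IH[OF y(1)] show ?case
  proof (elim disjE exE conjE)
    fix d assume d: "d \<le> D" "(u, y) \<in> A ^^ d" "even (d + n)"
    have "(u, u) \<in> A ^^ (Suc d + d')"
      using d(2) y(2) relpow_A_sym[OF d'(2)] unfolding relpow_add by auto
    then show ?thesis using d d' 
      by (cases "even (d' + Suc n)") (blast, intro disjI2 exI[of _ "Suc d + d'"], simp)
  qed auto
qed

text \<open>Either there is an even walk of length at most \<open>D\<close>, or a short odd closed
  walk at \<open>u\<close> corrects the parity of an odd one.\<close>

lemma two_step_distance:
  assumes "u \<in> V" "(u, u') \<in> class_rel"
  shows "\<exists>r\<le>2 * D. (u, u') \<in> (A O A) ^^ r"
proof -
  obtain n where n: "(u, u') \<in> A ^^ (2 * n)"
    using assms(2) unfolding class_rel_def by (metis rtrancl_imp_relpow two_step_relpow)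
  have "u' \<in> V" using assms n A_V by (cases "2 * n") auto
  then obtain d where d: "d \<le> D" "(u, u') \<in> A ^^ d" using dist_le assms(1) by blast
  have "\<exists>l\<le>4 * D. even l \<and> (u, u') \<in> A ^^ l"
    using short_even_walk_or_odd_cycle[OF assms(1) n]
  proof (elim disjE exE conjE)
    fix c assume c: "c \<le> 2 * D + 1" "odd c" "(u, u) \<in> A ^^ c"
    have cd: "(u, u') \<in> A ^^ (c + d)" using c(3) d(2) unfolding relpow_add by auto
    show ?thesis
    proof (cases "even d")
      case True
      then show ?thesis using d by (intro exI[of _ d]) auto
    next
      case False
      \<comment> \<open>The length is at most \<open>3 * D + 1\<close>, and an odd \<open>d\<close>
        up to \<open>D\<close> excludes \<open>D = 0\<close>.\<close>
      then have "c + d \<le> 4 * D" using c(1) d(1) by (cases D) auto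
      then show ?thesis using cd False c(2) by (intro exI[of _ "c + d"]) auto
    qed
  next
    fix d assume "d \<le> D" "(u, u') \<in> A ^^ d" "even (d + 2 * n)"
    then show ?thesis by (intro exI[of _ d]) auto
  qed
  then show ?thesis by (auto simp: two_step_relpow elim!: evenE)
qed

text \<open>On a shortest two-step path the intermediate vertices are distinct, so that their energy
  drops may be added up.\<close>

lemma shortest_two_step_path:
  assumes "u \<in> V" "(u, u') \<in> class_rel"
  obtains r f g where "r \<le> 2 * D" "f 0 = u" "f r = u'" "inj_on g {..<r}"
    "\<And>j. j < r \<Longrightarrow> (f j, g j) \<in> A \<and> (g j, f (Suc j)) \<in> A"
proof -
  define r where "r = (LEAST r. (u, u') \<in> (A O A) ^^ r)"
  obtain r' where r': "r' \<le> 2 * D" "(u, u') \<in> (A O A) ^^ r'" using two_step_distance[OF assms] by blast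
  have r: "(u, u') \<in> (A O A) ^^ r" "\<And>l. (u, u') \<in> (A O A) ^^ l \<Longrightarrow> r \<le> l"
    unfolding r_def using r'(2) by (rule LeastI, auto intro: Least_le)
  obtain f where f: "f 0 = u" "f r = u'" "\<And>j. j < r \<Longrightarrow> (f j, f (Suc j)) \<in> A O A"
    using r(1) unfolding relpow_fun_conv by blast
  then have "\<forall>j<r. \<exists>y. (f j, y) \<in> A \<and> (y, f (Suc j)) \<in> A" by blast
  then obtain g where g: "\<And>j. j < r \<Longrightarrow> (f j, g j) \<in> A \<and> (g j, f (Suc j)) \<in> A" by metis
  have part: "(f i, f (i + l)) \<in> (A O A) ^^ l" if "i + l \<le> r" for i l
    unfolding relpow_fun_conv using f(3) that by (intro exI[of _ "\<lambda>j. f (i + j)"]) auto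
  \<comment> \<open>Equal intermediate vertices would open a shortcut from \<open>f i\<close>
    directly to \<open>f (Suc j)\<close>.\<close>
  have no_repeat: False if "i < j" "j < r" "g i = g j" for i j
  proof -
    have "(f 0, f i) \<in> (A O A) ^^ i" using part[of 0 i] that by simp
    moreover have "(f i, f (Suc j)) \<in> A O A" using g[of i] g[of j] that by auto
    moreover have "(f (Suc j), f r) \<in> (A O A) ^^ (r - Suc j)" using part[of "Suc j" "r - Suc j"] that by simp
    ultimately have "(u, u') \<in> (A O A) ^^ (Suc i + (r - Suc j))"
      unfolding relpow_add f(1,2)[symmetric] by auto
    from r(2)[OF this] that show False by simp
  qed
  have "inj_on g {..<r}"
    by (rule inj_onI) (metis lessThan_iff linorder_neqE_nat no_repeat)
  then show ?thesis using that[of r f g] r(2)[OF r'(2)] r'(1) f g by auto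
qed

text \<open>Follow a shortest two-step path between the tails of the two arcs. Loads leaving a
  common vertex differ by at most 1, so most of \<Delta> arises between the two arcs entering some
  \<open>g j\<close>, where a difference costs energy. Cauchy-Schwarz turns the sum of these
  differences into a sum of squares.\<close>

lemma energy_drop_of_spread:
  assumes e: "e \<in> A" "e' \<in> A" "(fst e, fst e') \<in> class_rel"
    and \<Delta>: "\<Delta> = \<bar>W s i e - W s i e'\<bar>" "9 * int D \<le> \<Delta>"
  shows "\<Delta>\<^sup>2 \<le> 11 * int D * (\<Phi> i s - \<Phi> i (Suc s))"
proof -
  have "fst e \<in> V" using e A_V by auto
  then obtain r f g where r: "r \<le> 2 * D" and f: "f 0 = fst e" "f r = fst e'" and g: "inj_on g {..<r}"
    and arcs: "\<And>j. j < r \<Longrightarrow> (f j, g j) \<in> A \<and> (g j, f (Suc j)) \<in> A"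
    using shortest_two_step_path[OF _ e(3)] by metis
  have arcs': "(f (Suc j), g j) \<in> A" if "j < r" for j using arcs[OF that] sym_A by (auto dest: symD)
  define c where "c j = \<bar>W s i (f j, g j) - W s i (f (Suc j), g j)\<bar>" for j
  have fV: "f j \<in> V" if "j \<le> r" for j
    using that A_V \<open>fst e \<in> V\<close> f(1) arcs[of "j - 1"] by (cases j) auto
  have telescope: "\<bar>W s i e - W s i e''\<bar> \<le> (\<Sum>j<n. c j) + int n + 1"
    if "n \<le> r" "e'' \<in> out (f n)" for n e''
    using that
  proof (induction n arbitrary: e'')
    case 0
    have "e \<in> out (f 0)" using e f by (simp add: out_def)
    then show ?case using W_out_balanced[OF fV, of 0 e e'' s i] W_out_balanced[OF fV, of 0 e'' e s i] 0 by auto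
  next
    case (Suc n)
    have "(f n, g n) \<in> out (f n)" using arcs[of n] Suc.prems by (auto simp: out_def)
    then have "\<bar>W s i e - W s i (f n, g n)\<bar> \<le> (\<Sum>j<n. c j) + int n + 1" using Suc by simp
    moreover have "(f (Suc n), g n) \<in> out (f (Suc n))" using arcs'[of n] Suc.prems by (auto simp: out_def)
    then have "\<bar>W s i (f (Suc n), g n) - W s i e''\<bar> \<le> 1"
      using W_out_balanced[OF fV, of "Suc n" "(f (Suc n), g n)" e'' s i]
        W_out_balanced[OF fV, of "Suc n" e'' "(f (Suc n), g n)" s i] Suc.prems by auto
    ultimately show ?case by (simp add: c_def)
  qed
  have "e' \<in> out (f r)" using e f by (simp add: out_def)
  then have "\<Delta> \<le> (\<Sum>j<r. c j) + int r + 1" using telescope[of r e'] \<Delta> by simp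
  then have S: "real_of_int \<Delta> - 3 * real D \<le> (\<Sum>j<r. real_of_int (c j))"
  proof -
    assume "\<Delta> \<le> (\<Sum>j<r. c j) + int r + 1"
    \<comment> \<open>The rounding losses are \<open>r + 1\<close>, at most \<open>2 * D + 1\<close>
      and so at most \<open>3 * D\<close>, a third of \<Delta>.\<close>
    then have "\<Delta> - 3 * int D \<le> (\<Sum>j<r. c j)" using r D_pos by linarith
    then show ?thesis by (metis (mono_tags) of_int_diff of_int_le_iff of_int_mult of_int_numeral of_int_of_nat_eq of_int_sum)
  qed
  define Q where "Q = (\<Sum>j<r. (real_of_int (c j))\<^sup>2)"
  have Q_drop: "Q - 2 * real D \<le> 2 * real_of_int (\<Phi> i s - \<Phi> i (Suc s))"
  proof -
    have gV: "g j \<in> V" if "j < r" for j using arcs[OF that] A_V by auto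
    have "(\<Sum>j<r. (c j)\<^sup>2 - 1) \<le> (\<Sum>j<r. 2 * energy_drop s i (g j))"
    proof (intro sum_mono)
      fix j assume "j \<in> {..<r}"
      then have "(W s i (f j, g j) - W s i (f (Suc j), g j))\<^sup>2 - 1 \<le> 2 * energy_drop s i (g j)"
        using arcs[of j] arcs'[of j] gV[of j] by (intro energy_drop_ge) (auto simp: inn_def)
      then show "(c j)\<^sup>2 - 1 \<le> 2 * energy_drop s i (g j)" by (simp add: c_def)
    qed
    also have "\<dots> = 2 * (\<Sum>v\<in>g ` {..<r}. energy_drop s i v)"
      by (simp add: sum.reindex[OF g] sum_distrib_left)
    also have "\<dots> \<le> 2 * (\<Phi> i s - \<Phi> i (Suc s))"
      unfolding \<Phi>_diff using fin_V gV energy_drop_nonneg by (intro mult_left_mono sum_mono2) auto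
    finally have "(\<Sum>j<r. (c j)\<^sup>2) - 2 * int D \<le> 2 * (\<Phi> i s - \<Phi> i (Suc s))"
      using r by (simp add: sum_subtractf)
    then have "real_of_int ((\<Sum>j<r. (c j)\<^sup>2) - 2 * int D) \<le> real_of_int (2 * (\<Phi> i s - \<Phi> i (Suc s)))"
      by (simp only: of_int_le_iff)
    then show ?thesis by (simp add: Q_def)
  qed
  have "0 \<le> Q" unfolding Q_def by (intro sum_nonneg) auto
  have \<Delta>': "9 * real D \<le> real_of_int \<Delta>" using \<Delta>(2) by linarith
  have "(2 / 3 * real_of_int \<Delta>)\<^sup>2 \<le> (\<Sum>j<r. real_of_int (c j))\<^sup>2"
    using S \<Delta>' by (intro power_mono) auto
  also have "\<dots> \<le> real r * Q"
    using sum_squared_le_card_mult_sum_squares[of "\<lambda>j. real_of_int (c j)" "{..<r}"] by (simp add: Q_def)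
  also have "\<dots> \<le> 2 * real D * Q" using r \<open>0 \<le> Q\<close> by (intro mult_right_mono) auto
  finally have 1: "4 / 9 * (real_of_int \<Delta>)\<^sup>2 \<le> 2 * (real D * Q)" by (simp add: power2_eq_square)
  have 2: "real D * Q - 2 * (real D)\<^sup>2 \<le> 2 * (real D * real_of_int (\<Phi> i s - \<Phi> i (Suc s)))"
    using mult_left_mono[OF Q_drop, of "real D"] by (simp add: power2_eq_square algebra_simps)
  have "(9 * real D)\<^sup>2 \<le> (real_of_int \<Delta>)\<^sup>2" using \<Delta>' by (intro power_mono) auto
  then have 3: "81 * (real D)\<^sup>2 \<le> (real_of_int \<Delta>)\<^sup>2" by simp
  \<comment> \<open>Absorbing the term in the square of \<open>D\<close> by the third inequality
    leaves 32/81 of the square of \<Delta> against 4 times \<open>D\<close> times the drop, and 81/8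
    is below 11.\<close>
  have "(real_of_int \<Delta>)\<^sup>2 \<le> 11 * (real D * real_of_int (\<Phi> i s - \<Phi> i (Suc s)))"
    using 1 2 3 zero_le_power2[of "real_of_int \<Delta>"] by linarith
  then have "real_of_int (\<Delta>\<^sup>2) \<le> real_of_int (11 * int D * (\<Phi> i s - \<Phi> i (Suc s)))" by simp
  then show ?thesis by (simp only: of_int_le_iff)
qed

text \<open>The energy relative to any reference profile that is constant on the classes and moves with
  the tokens differs from \<open>\<Phi>\<close> by a conserved quantity. Working with such profiles treats bipartite
  and non-bipartite graphs alike.\<close>

lemma \<Phi>_diff_le_spread:
  assumes "s \<le> t"
    and spread: "\<And>e e'. e \<in> A \<Longrightarrow> e' \<in> A \<Longrightarrow> (fst e, fst e') \<in> class_rel \<Longrightarrow> \<bar>W s i e - W s i e'\<bar> \<le> \<Delta>"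
  shows "\<Phi> i s - \<Phi> i t \<le> int (card A) * \<Delta>\<^sup>2"
proof -
  define c0 where "c0 v = Min (W s i ` {e \<in> A. (v, fst e) \<in> class_rel})" for v
  \<comment> \<open>All neighbours of \<open>v\<close> lie in one class, so the choice is
    immaterial. Alternating between the class of the vertex and that of its neighbours makes the
    profile travel with the tokens.\<close>
  define c where "c n v = (if even n then c0 v else c0 (SOME u. (v, u) \<in> A))" for n :: nat and v
  have c0_class: "c0 u = c0 v" if "(u, v) \<in> class_rel" for u v
  proof -
    have "{e \<in> A. (u, fst e) \<in> class_rel} = {e \<in> A. (v, fst e) \<in> class_rel}"
      using that class_rel_sym class_rel_trans by blast
    then show ?thesis by (simp add: c0_def)
  qed
  have c0_some: "c0 (SOME y. (v, y) \<in> A) = c0 u" if "(v, u) \<in> A" for u v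
  proof (rule c0_class)
    have "(v, SOME y. (v, y) \<in> A) \<in> A" using that by (rule someI)
    then have "(u, SOME y. (v, y) \<in> A) \<in> A O A" using that sym_A by (auto dest: symD)
    then show "(SOME y. (v, y) \<in> A, u) \<in> class_rel"
      using class_rel_sym unfolding class_rel_def by blast
  qed
  have c_step: "c (Suc n) (snd e) = c n (fst e)" if "e \<in> A" for n e
  proof -
    obtain u v where e: "e = (u, v)" by (cases e)
    then have "(u, v) \<in> A" "(v, u) \<in> A" using that sym_A by (auto dest: symD)
    then show ?thesis using c0_some[of v u] c0_some[of u v] by (simp add: c_def e)
  qed
  define \<Psi> where "\<Psi> n = (\<Sum>e\<in>A. (W (s + n) i e - c n (fst e))\<^sup>2)" for n
  have conserved: "\<Phi> i (s + Suc n) - \<Psi> (Suc n) = \<Phi> i (s + n) - \<Psi> n" for n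
  proof -
    \<comment> \<open>The squares of the loads cancel; what remains is linear in the loads, and
      conservation of tokens transports it from step to step.\<close>
    have *: "\<Phi> i (s + n) - \<Psi> n = 2 * (\<Sum>e\<in>A. c n (fst e) * W (s + n) i e) - (\<Sum>e\<in>A. (c n (fst e))\<^sup>2)" for n
      unfolding \<Phi>_def \<Psi>_def sum_subtractf[symmetric] sum_distrib_left
      by (intro sum.cong refl) (simp add: power2_eq_square algebra_simps)
    have out_to_inn: "(\<Sum>e\<in>out v. c (Suc n) v * W (Suc (s + n)) i e) = (\<Sum>e\<in>inn v. c (Suc n) v * W (s + n) i e)"
      if "v \<in> V" for v
      unfolding sum_distrib_left[symmetric] using W_conservation[OF that] by simp
    have "(\<Sum>e\<in>A. c (Suc n) (fst e) * W (s + Suc n) i e)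
        = (\<Sum>v\<in>V. \<Sum>e\<in>out v. c (Suc n) v * W (Suc (s + n)) i e)"
      unfolding sum_out[symmetric] by (intro sum.cong refl) (auto simp: out_def)
    also have "\<dots> = (\<Sum>v\<in>V. \<Sum>e\<in>inn v. c (Suc n) v * W (s + n) i e)"
      using out_to_inn by (rule sum.cong[OF refl])
    also have "\<dots> = (\<Sum>v\<in>V. \<Sum>e\<in>inn v. c n (fst e) * W (s + n) i e)"
      by (intro sum.cong refl) (use c_step in \<open>auto simp: inn_def\<close>)
    also have "\<dots> = (\<Sum>e\<in>A. c n (fst e) * W (s + n) i e)" by (rule sum_inn)
    finally have lin: "(\<Sum>e\<in>A. c (Suc n) (fst e) * W (s + Suc n) i e) = (\<Sum>e\<in>A. c n (fst e) * W (s + n) i e)" .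
    have "(\<Sum>e\<in>A. (c (Suc n) (fst e))\<^sup>2) = (\<Sum>e\<in>A. (c (Suc n) (snd e))\<^sup>2)"
      by (rule sum.reindex_bij_witness[of _ prod.swap prod.swap]) (use sym_A in \<open>auto dest: symD\<close>)
    also have "\<dots> = (\<Sum>e\<in>A. (c n (fst e))\<^sup>2)" using c_step by (intro sum.cong refl) auto
    finally show ?thesis unfolding * lin by simp
  qed
  have "\<Phi> i (s + n) - \<Psi> n = \<Phi> i s - \<Psi> 0" for n
    by (induction n) (use conserved in auto)
  moreover have "0 \<le> \<Psi> n" for n unfolding \<Psi>_def by (intro sum_nonneg) auto
  \<comment> \<open>Since the two energies differ by a constant, the drop of \<Phi> is that of
    \<Psi>, which is at most its initial value.\<close>
  ultimately have "\<Phi> i s - \<Phi> i (s + (t - s)) \<le> \<Psi> 0" by (smt (verit))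
  then have "\<Phi> i s - \<Phi> i t \<le> \<Psi> 0" using \<open>s \<le> t\<close> by simp
  also have "\<Psi> 0 \<le> (\<Sum>e\<in>A. \<Delta>\<^sup>2)"
    unfolding \<Psi>_def
  proof (intro sum_mono)
    fix e assume e: "e \<in> A"
    let ?X = "{e' \<in> A. (fst e, fst e') \<in> class_rel}"
    have "c0 (fst e) \<in> W s i ` ?X"
    proof -
      have "e \<in> ?X" using e by (simp add: class_rel_def)
      then show ?thesis unfolding c0_def using fin_A by (intro Min_in) (simp, blast)
    qed
    then have "\<bar>W s i e - c0 (fst e)\<bar> \<le> \<Delta>" using spread[OF e] by auto
    then have "\<bar>W s i e - c0 (fst e)\<bar>\<^sup>2 \<le> \<Delta>\<^sup>2" by (intro power_mono) auto
    then show "(W (s + 0) i e - c 0 (fst e))\<^sup>2 \<le> \<Delta>\<^sup>2" by (simp add: c_def)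
  qed
  finally show ?thesis by simp
qed

text \<open>Let \<Delta> be the largest spread within a class. The excess is at most
  \<open>card A\<close> times its square. If \<Delta> is at most \<open>9 * D\<close>, this is the
  first alternative; otherwise \<open>energy_drop_of_spread\<close> bounds the square by a single
  step's drop.\<close>

lemma excess_small_or_contracts:
  assumes "s \<le> t"
  shows "\<Phi> i s - \<Phi> i t \<le> 81 * int (card A) * (int D)\<^sup>2 \<or>
    \<Phi> i s - \<Phi> i t \<le> 11 * int (card A) * int D * (\<Phi> i s - \<Phi> i (Suc s))"
proof -
  define P where "P = {(e, e'). e \<in> A \<and> e' \<in> A \<and> (fst e, fst e') \<in> class_rel}"
  define sp where "sp = (\<lambda>(e, e'). \<bar>W s i e - W s i e'\<bar>)"
  have finP: "finite P" unfolding P_def by (rule finite_subset[of _ "A \<times> A"]) (use fin_A in auto)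
  show ?thesis
  proof (cases "\<forall>p\<in>P. sp p \<le> 9 * int D")
    case True
    then have "\<Phi> i s - \<Phi> i t \<le> int (card A) * (9 * int D)\<^sup>2"
      using assms by (intro \<Phi>_diff_le_spread) (auto simp: P_def sp_def)
    then show ?thesis by (simp add: power2_eq_square)
  next
    case False
    then have "P \<noteq> {}" by auto
    then have "Max (sp ` P) \<in> sp ` P" using finP by (intro Max_in) auto
    then obtain e e' where e: "(e, e') \<in> P" "Max (sp ` P) = \<bar>W s i e - W s i e'\<bar>" by (auto simp: sp_def)
    have max: "sp p \<le> \<bar>W s i e - W s i e'\<bar>" if "p \<in> P" for p
      unfolding e(2)[symmetric] using finP that by (intro Max_ge) auto
    have "9 * int D \<le> \<bar>W s i e - W s i e'\<bar>" using False max by fastforce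
    then have "\<bar>W s i e - W s i e'\<bar>\<^sup>2 \<le> 11 * int D * (\<Phi> i s - \<Phi> i (Suc s))"
      using e by (intro energy_drop_of_spread) (auto simp: P_def)
    then have "int (card A) * \<bar>W s i e - W s i e'\<bar>\<^sup>2 \<le> int (card A) * (11 * int D * (\<Phi> i s - \<Phi> i (Suc s)))"
      by (intro mult_left_mono) auto
    moreover have "\<Phi> i s - \<Phi> i t \<le> int (card A) * \<bar>W s i e - W s i e'\<bar>\<^sup>2"
      using assms max by (intro \<Phi>_diff_le_spread) (auto simp: P_def sp_def)
    ultimately have "\<Phi> i s - \<Phi> i t \<le> int (card A) * (11 * int D * (\<Phi> i s - \<Phi> i (Suc s)))"
      by linarith
    then show ?thesis by (simp add: mult.assoc mult.left_commute)
  qed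
qed

section \<open>Exponential decay of the excess\<close>

lemma card_A_pos: "0 < k \<Longrightarrow> 0 < card A"
  using total_load[of 0] fin_A by (cases "A = {}") (auto simp: card_gt_0_iff)

text \<open>If the bound failed at \<open>T\<close>, it would fail at all earlier times as well, so
  each of the first \<open>T\<close> steps would contract the excess by \<open>1 - 1 / b\<close>.
  That brings it from at most the square of \<open>i * k\<close> down to 1, a contradiction.\<close>

lemma excess_le:
  assumes "0 < i" "0 < k" "T \<le> H" "22 * card A * D * ln (i * k) \<le> real T"
  shows "\<Phi> i T - \<Phi> i H \<le> 81 * int (card A) * (int D)\<^sup>2"
proof (rule ccontr)
  assume large: "\<not> ?thesis"
  define b where "b = 11 * real (card A) * real D"
  have pos: "1 \<le> card A" "1 \<le> D" using card_A_pos D_pos assms(2) by (simp_all add: Suc_leI)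
  have "1 * 1 \<le> real (card A) * real D" using pos by (intro mult_mono) auto
  then have b: "1 < b" unfolding b_def by linarith
  define X where "X t = real_of_int (\<Phi> i t - \<Phi> i H)" for t
  have contract: "X (Suc t) \<le> (1 - 1 / b) * X t" if "t < T" for t
  proof -
    have "\<not> \<Phi> i t - \<Phi> i H \<le> 81 * int (card A) * (int D)\<^sup>2"
      using large \<Phi>_antimono[of t T i] that by linarith
    then have "\<Phi> i t - \<Phi> i H \<le> 11 * int (card A) * int D * (\<Phi> i t - \<Phi> i (Suc t))"
      using excess_small_or_contracts[of t H i] that assms(3) by auto
    then have "real_of_int (\<Phi> i t - \<Phi> i H) \<le> real_of_int (11 * int (card A) * int D * (\<Phi> i t - \<Phi> i (Suc t)))"
      by (simp only: of_int_le_iff)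
    then have "X t \<le> b * (X t - X (Suc t))" by (simp add: X_def b_def)
    then show ?thesis using b by (simp add: field_simps)
  qed
  have X_le: "X t \<le> (1 - 1 / b) ^ t * X 0" if "t \<le> T" for t
    using that
  proof (induction t)
    case (Suc t)
    have "X (Suc t) \<le> (1 - 1 / b) * X t" using contract Suc.prems by simp
    also have "\<dots> \<le> (1 - 1 / b) * ((1 - 1 / b) ^ t * X 0)"
      using Suc b by (intro mult_left_mono) auto
    finally show ?case by simp
  qed simp
  define z where "z = real i * real k"
  have z: "0 < z" using assms(1,2) by (simp add: z_def)
  have X0: "X 0 \<le> z\<^sup>2"
  proof -
    have "\<Phi> i 0 - \<Phi> i H \<le> (int (i * k))\<^sup>2" using \<Phi>_le[of i 0] \<Phi>_nonneg[of i H] by linarith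
    then have "real_of_int (\<Phi> i 0 - \<Phi> i H) \<le> real_of_int ((int (i * k))\<^sup>2)" by (simp only: of_int_le_iff)
    then show ?thesis by (simp add: X_def z_def)
  qed
  have "(1 - 1 / b) ^ T \<le> exp (- 1 / b) ^ T"
    using b exp_ge_add_one_self[of "- 1 / b"] by (intro power_mono) auto
  also have "\<dots> = exp (- (real T / b))" by (simp flip: exp_of_nat_mult)
  also have "\<dots> \<le> exp (- ln (z\<^sup>2))"
  proof -
    have "2 * (b * ln z) \<le> real T" using assms(4) by (simp add: b_def z_def mult.assoc)
    then have "2 * ln z \<le> real T / b" using b by (simp add: pos_le_divide_eq mult.commute mult.left_commute)
    moreover have "ln (z\<^sup>2) = 2 * ln z" by (simp add: ln_realpow)
    ultimately show ?thesis by simp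
  qed
  also have "\<dots> = 1 / z\<^sup>2" using z by (simp add: exp_minus inverse_eq_divide)
  finally have pow: "(1 - 1 / b) ^ T \<le> 1 / z\<^sup>2" .
  have "X T \<le> (1 - 1 / b) ^ T * X 0" using X_le by simp
  also have "\<dots> \<le> (1 / z\<^sup>2) * z\<^sup>2"
    using pow X0 \<Phi>_antimono[of 0 H i] by (intro mult_mono) (auto simp: X_def)
  also have "\<dots> = 1" using z by simp
  finally have "\<Phi> i T - \<Phi> i H \<le> 1" by (simp add: X_def)
  moreover have "1 * 1 \<le> int (card A) * (int D)\<^sup>2" using pos by (intro mult_mono) auto
  ultimately have "\<Phi> i T - \<Phi> i H \<le> 81 * (int (card A) * (int D)\<^sup>2)" by linarith
  then show False using large by (simp add: mult.assoc)
qed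

end

section \<open>Periodicity of the loads\<close>

text \<open>Two of the first \<open>card X + 1\<close> iterates coincide, and the common power of
  the bijection cancels.\<close>

lemma funpow_returns:
  assumes "finite X" "bij_betw f X X" "y \<in> X"
  shows "\<exists>l. 0 < l \<and> l \<le> card X \<and> (f ^^ l) y = y"
proof -
  have inX: "(f ^^ n) y \<in> X" for n
    using assms(2,3) by (induction n) (auto simp: bij_betw_def)
  then have "(\<lambda>n. (f ^^ n) y) ` {..card X} \<subseteq> X" by blast
  then have "card ((\<lambda>n. (f ^^ n) y) ` {..card X}) \<le> card X" using assms(1) by (rule card_mono[rotated])
  then have "\<not> inj_on (\<lambda>n. (f ^^ n) y) {..card X}" using card_image by fastforce
  then obtain i j where ij: "i < j" "j \<le> card X" "(f ^^ i) y = (f ^^ j) y"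
    unfolding inj_on_def by (metis atMost_iff linorder_neqE_nat)
  have "bij_betw (f ^^ i) X X" using assms(2) by (induction i) (auto intro: bij_betw_trans simp: bij_betw_id)
  moreover have "(f ^^ i) ((f ^^ (j - i)) y) = (f ^^ i) y"
  proof -
    have "(f ^^ i) ((f ^^ (j - i)) y) = (f ^^ (i + (j - i))) y" by (simp only: funpow_add comp_apply)
    then show ?thesis using ij by simp
  qed
  ultimately have "(f ^^ (j - i)) y = y" using inX assms(3) by (auto simp: bij_betw_def dest: inj_onD)
  then show ?thesis using ij by (intro exI[of _ "j - i"]) auto
qed

text \<open>The horizon \<open>r\<close> is there because, during the induction in
  \<open>eventually_matched\<close>, periodicity is known only on an initial stretch.\<close>

lemma periodic_mult:
  fixes h :: "nat \<Rightarrow> 'b"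
  assumes "\<And>q. q + l \<le> r \<Longrightarrow> h (q + l) = h q" "q + n * l \<le> r"
  shows "h (q + n * l) = h q"
  using assms(2)
proof (induction n)
  case (Suc n)
  then have "h (q + n * l + l) = h (q + n * l)" by (intro assms(1)) (simp add: algebra_simps)
  with Suc show ?case by (simp add: algebra_simps)
qed simp

context token_loads begin

text \<open>With \<open>a = card A\<close>, this exceeds twice the product of any two return times
  and is no less than the longest window, \<open>2 * a + 1\<close>.\<close>

definition block :: nat where "block = 2 * (card A)\<^sup>2 + 2 * card A + 1"

text \<open>Match the arcs entering \<open>v\<close>, sorted by load, with the arcs leaving
  \<open>v\<close> in rotor order. As long as the sorted side stays descending and balanced,
  \<open>balanced_descending_unique\<close> makes matched arcs carry equal window loads one step
  apart. That it stays so forever is shown by induction on time.\<close>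

lemma eventually_matched:
  assumes bal: "\<And>q i v e e'. s \<le> q \<Longrightarrow> q < s + block \<Longrightarrow> i \<le> 2 * card A + 1 \<Longrightarrow>
      v \<in> V \<Longrightarrow> e \<in> inn v \<Longrightarrow> e' \<in> inn v \<Longrightarrow> W q i e \<le> W q i e' + 1"
  shows "\<exists>\<pi>. bij_betw \<pi> A A \<and> (\<forall>r. \<forall>e\<in>A. x (s + r) e = x (s + Suc r) (\<pi> e))"
proof -
  define I where "I = 2 * card A + 1"
  have I_block: "I \<le> block" by (simp add: I_def block_def)
  \<comment> \<open>Summing over all windows up to \<open>I\<close> yields one order compatible with
    each of them: two arcs' differences vary by at most 1 and start at 0, so they cannot take both
    signs.\<close>
  define key where "key e = (\<Sum>i\<le>I. W s i e)" for e
  have "\<forall>v\<in>V. \<exists>g. bij_betw g {..<card (out v)} (inn v) \<and>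
      (\<forall>j j'. j < j' \<longrightarrow> j' < card (out v) \<longrightarrow> key (g j') \<le> key (g j))"
    using ex_descending_enumeration[OF fin_inn, of _ key] by (simp add: card_inn)
  then obtain g where g: "\<And>v. v \<in> V \<Longrightarrow> bij_betw (g v) {..<card (out v)} (inn v)"
    and g_key: "\<And>v j j'. v \<in> V \<Longrightarrow> j < j' \<Longrightarrow> j' < card (out v) \<Longrightarrow> key (g v j') \<le> key (g v j)"
    by metis
  have "\<forall>v\<in>V. \<exists>f. bij_betw f {..<card (out v)} (out v) \<and>
      (\<forall>i j j'. j < j' \<longrightarrow> j' < card (out v) \<longrightarrow>
        W (Suc s) i (f j') \<le> W (Suc s) i (f j) \<and> W (Suc s) i (f j) \<le> W (Suc s) i (f j') + 1)"
    using ex_rotor_enumeration by blast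
  then obtain f where f: "\<And>v. v \<in> V \<Longrightarrow> bij_betw (f v) {..<card (out v)} (out v)"
    and f_ord: "\<And>v i j j'. v \<in> V \<Longrightarrow> j < j' \<Longrightarrow> j' < card (out v) \<Longrightarrow>
        W (Suc s) i (f v j') \<le> W (Suc s) i (f v j) \<and> W (Suc s) i (f v j) \<le> W (Suc s) i (f v j') + 1"
    by metis
  define \<pi> where "\<pi> e = f (snd e) (inv_into {..<card (out (snd e))} (g (snd e)) e)" for e
  have g_inn: "g v j \<in> inn v" if "v \<in> V" "j < card (out v)" for v j
    using g[OF that(1)] that(2) by (auto simp: bij_betw_def)
  have \<pi>_g: "\<pi> (g v j) = f v j" if "v \<in> V" "j < card (out v)" for v j
    using g_inn[OF that] g[OF that(1)] that(2) by (simp add: \<pi>_def inn_def bij_betw_def)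
  have arc_g: "\<exists>v\<in>V. \<exists>j<card (out v). e = g v j" if "e \<in> A" for e
  proof -
    have "snd e \<in> V" "e \<in> inn (snd e)" using that A_V by (auto simp: inn_def)
    then show ?thesis using g[of "snd e"] unfolding bij_betw_def by blast
  qed
  have f_out: "f v j \<in> out v" if "v \<in> V" "j < card (out v)" for v j
    using f[OF that(1)] that(2) by (auto simp: bij_betw_def)
  have "inj_on \<pi> A"
  proof (rule inj_onI)
    fix e e' assume "e \<in> A" "e' \<in> A" and eq: "\<pi> e = \<pi> e'"
    then obtain v j v' j' where *: "v \<in> V" "j < card (out v)" "e = g v j"
        "v' \<in> V" "j' < card (out v')" "e' = g v' j'" using arc_g by metis
    then have "f v j = f v' j'" using eq \<pi>_g by simp
    moreover have "v = v'" using f_out[of v j] f_out[of v' j'] * calculation by (auto simp: out_def)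
    ultimately have "j = j'" using f[of v] * by (auto simp: bij_betw_def dest: inj_onD)
    then show "e = e'" using * \<open>v = v'\<close> by simp
  qed
  moreover have "\<pi> ` A \<subseteq> A" using arc_g \<pi>_g f_out by (force simp: out_def)
  ultimately have \<pi>_bij: "bij_betw \<pi> A A" using fin_A by (simp add: bij_betw_def endo_inj_surj)

  define \<delta> where "\<delta> v j j' q = W s q (g v j) - W s q (g v j')" for v j j' q
  \<comment> \<open>Only the start of the window from \<open>q\<close> to \<open>q'\<close> has to
    lie in the block; its end may lie beyond. This carries into the bound
    \<open>\<delta>_window\<close> below.\<close>
  have \<delta>_Suc: "\<delta> v j j' (Suc q) = \<delta> v j j' q + (x (s + q) (g v j) - x (s + q) (g v j'))" for v j j' q
    by (simp add: \<delta>_def W_Suc)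
  have \<delta>_window: "\<bar>\<delta> v j j' q' - \<delta> v j j' q\<bar> \<le> 1"
    if "v \<in> V" "j < card (out v)" "j' < card (out v)" "q \<le> q'" "q < block" "q' - q \<le> I" for v j j' q q'
  proof -
    have "W s q' e = W s q e + W (s + q) (q' - q) e" for e using W_add[of s q "q' - q" e] that by simp
    moreover have "W (s + q) (q' - q) (g v j) \<le> W (s + q) (q' - q) (g v j') + 1"
      "W (s + q) (q' - q) (g v j') \<le> W (s + q) (q' - q) (g v j) + 1"
      using that g_inn I_def by (auto intro!: bal)
    ultimately show ?thesis unfolding \<delta>_def by (simp add: abs_le_iff)
  qed
  have \<delta>_initial: "\<delta> v j j' q \<in> {0, 1}"
    if v: "v \<in> V" "j < j'" "j' < card (out v)" and q: "q \<le> I" for v j j' q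
  proof -
    have close: "\<bar>\<delta> v j j' q - \<delta> v j j' q'\<bar> \<le> 1" if "q \<le> I" "q' \<le> I" for q q'
    proof (cases "q' = q")
      case False
      then show ?thesis
        using \<delta>_window[of v j j' q' q] \<delta>_window[of v j j' q q'] that v I_block
        by (cases "q' < q") (auto simp: abs_minus_commute)
    qed simp
    have "0 \<le> \<delta> v j j' q"
    proof (rule ccontr)
      assume neg: "\<not> 0 \<le> \<delta> v j j' q"
      then have "\<delta> v j j' q' \<le> 0" if "q' \<le> I" for q' using close[OF q that] by linarith
      then have "(\<Sum>i\<le>I. \<delta> v j j' i) < (\<Sum>i\<le>I. 0)"
        using neg q by (intro sum_strict_mono_ex1) force+
      then have "key (g v j) < key (g v j')" by (simp add: key_def \<delta>_def sum_subtractf)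
      with g_key[OF v] show False by simp
    qed
    moreover have "\<delta> v j j' q \<le> 1" using close[OF q, of 0] by (simp add: \<delta>_def)
    ultimately show ?thesis by auto
  qed
  \<comment> \<open>The induction hypothesis: up to length \<open>r\<close>, windows from
    \<open>s\<close> respect the sorted order with differences 0 or 1.\<close>
  define Q where "Q r \<longleftrightarrow> (\<forall>v\<in>V. \<forall>j j' q. j < j' \<longrightarrow> j' < card (out v) \<longrightarrow> q \<le> r \<longrightarrow> \<delta> v j j' q \<in> {0, 1})" for r
  have step: "x (s + q) e = x (s + Suc q) (\<pi> e)" if "Q r" "q < r" "e \<in> A" for r q e
  proof -
    from arc_g[OF that(3)] obtain v j where v: "v \<in> V" "j < card (out v)" "e = g v j" by blast
    have "W s q (g v j) = W (Suc s) q (f v j)" if "q \<le> r" for q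
    proof (rule balanced_descending_unique[of "card (out v)" "\<lambda>j. W s q (g v j)" "\<lambda>j. W (Suc s) q (f v j)" j])
      show "W s q (g v j') \<le> W s q (g v j) \<and> W s q (g v j) \<le> W s q (g v j') + 1"
        if "j < j'" "j' < card (out v)" for j j'
      proof -
        have "\<delta> v j j' q \<in> {0, 1}" using \<open>Q r\<close> v(1) that \<open>q \<le> r\<close> unfolding Q_def by blast
        then show ?thesis by (auto simp: \<delta>_def)
      qed
      show "(\<Sum>j<card (out v). W s q (g v j)) = (\<Sum>j<card (out v). W (Suc s) q (f v j))"
        using W_conservation[OF v(1), of s q]
        by (simp add: sum.reindex_bij_betw[OF g[OF v(1)]] sum.reindex_bij_betw[OF f[OF v(1)]])
    qed (use f_ord v in auto)
    from this[of q] this[of "Suc q"] \<open>q < r\<close> show ?thesis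
      unfolding v(3) \<pi>_g[OF v(1,2)] W_Suc by simp
  qed
  have iterate: "x (s + q) e = x (s + (q + n)) ((\<pi> ^^ n) e) \<and> (\<pi> ^^ n) e \<in> A"
    if "Q r" "q + n \<le> r" "e \<in> A" for r q n e
    using that(2)
  proof (induction n)
    case (Suc n)
    then show ?case using step[OF that(1), of "q + n" "(\<pi> ^^ n) e"] \<pi>_bij
      by (auto simp: bij_betw_def)
  qed (use that in simp)
  have "\<forall>e\<in>A. \<exists>l. 0 < l \<and> l \<le> card A \<and> (\<pi> ^^ l) e = e"
    using funpow_returns[OF fin_A \<pi>_bij] by blast
  then obtain l where l: "\<And>e. e \<in> A \<Longrightarrow> 0 < l e \<and> l e \<le> card A \<and> (\<pi> ^^ l e) e = e" by metis
  \<comment> \<open>Following \<pi> once around its cycle through \<open>e\<close> returns to the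
    same arc \<open>l e\<close> steps later.\<close>
  have period: "x (s + (q + l e)) e = x (s + q) e" if "Q r" "q + l e \<le> r" "e \<in> A" for r q e
    using iterate[OF that] l[OF that(3)] by simp
  have extend: "Q (Suc r)" if "Q r" for r
    unfolding Q_def
  proof (intro ballI allI impI)
    fix v j j' q assume v: "v \<in> V" and j: "j < j'" "j' < card (out v)" and q: "q \<le> Suc r"
    have old: "\<delta> v j j' q \<in> {0, 1}" if "q \<le> r" for q using \<open>Q r\<close> that v j unfolding Q_def by blast
    let ?e = "g v j" and ?e' = "g v j'"
    have eA: "?e \<in> A" "?e' \<in> A" using g_inn[OF v] j by (auto simp: inn_def)
    note le = l[OF eA(1)] and le' = l[OF eA(2)]
    have "\<delta> v j j' (Suc r) \<in> {0, 1}"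
    proof (cases "Suc r \<le> I")
      case True
      then show ?thesis using \<delta>_initial v j by blast
    next
      case False
      show ?thesis
      proof (cases "r < block")
        case True
        text \<open>A value outside \<open>{0, 1}\<close> would need a stretch longer than the sum of the two periods on which
          the loads of both arcs agree; by the theorem of Fine and Wilf they agree one step further.\<close>
        show ?thesis
        proof (rule ccontr)
          assume bad: "\<delta> v j j' (Suc r) \<notin> {0, 1}"
          \<comment> \<open>A bad value is -1 or 2, and every recent value lies in
            \<open>{0, 1}\<close> within distance 1 of it; so all of these are the same.\<close>
          have const: "\<delta> v j j' q = \<delta> v j j' r" if "q \<le> r" "Suc r - q \<le> I" for q
          proof -
            have "\<bar>\<delta> v j j' (Suc r) - \<delta> v j j' q\<bar> \<le> 1"
              by (rule \<delta>_window) (use v j that True in auto)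
            moreover have "\<bar>\<delta> v j j' (Suc r) - \<delta> v j j' r\<bar> \<le> 1"
              by (rule \<delta>_window) (use v j True in \<open>auto simp: I_def\<close>)
            moreover have "\<delta> v j j' q \<in> {0, 1}" "\<delta> v j j' r \<in> {0, 1}" using old that(1) by blast+
            ultimately show ?thesis using bad unfolding insert_iff empty_iff by linarith
          qed
          have eq: "x (s + q) ?e = x (s + q) ?e'" if "q < r" "Suc r - q \<le> I" for q
            using const[of q] const[of "Suc q"] that \<delta>_Suc[of v j j' q] by simp
          have rl: "l ?e + l ?e' < I" using le le' by (simp add: I_def)
          define p where "p = r - l ?e - l ?e'"
          have p: "r = p + l ?e + l ?e'" "r = p + l ?e' + l ?e" using rl False by (auto simp: p_def)
          have "x (s + r) ?e = x (s + (p + l ?e')) ?e" using period[OF \<open>Q r\<close> _ eA(1), of "p + l ?e'"] p(2) by simp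
          also have "\<dots> = x (s + (p + l ?e')) ?e'" by (rule eq; use p rl le le' in linarith)
          also have "\<dots> = x (s + p) ?e'" using period[OF \<open>Q r\<close> _ eA(2), of p] p by simp
          also have "\<dots> = x (s + p) ?e" by (rule eq[symmetric]; use p rl le le' in linarith)
          also have "\<dots> = x (s + (p + l ?e)) ?e" using period[OF \<open>Q r\<close> _ eA(1), of p] p by simp
          also have "\<dots> = x (s + (p + l ?e)) ?e'" by (rule eq; use p rl le le' in linarith)
          also have "\<dots> = x (s + r) ?e'" using period[OF \<open>Q r\<close> _ eA(2), of "p + l ?e"] p(1) by simp
          finally have "\<delta> v j j' (Suc r) = \<delta> v j j' r" by (simp add: \<delta>_Suc)
          with bad old[of r] show False by simp
        qed
      next
        case False
        text \<open>Both loads have the common period \<open>p\<close>, and two periods fit into the past, so a nonzero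
          drift of the difference would already have been seen.\<close>
        define p where "p = l ?e * l ?e'"
        have "p \<le> card A * card A" unfolding p_def using le le' by (intro mult_mono) auto
        then have p2: "2 * p \<le> r" using False by (simp add: block_def power2_eq_square)
        have "0 < p" using le le' by (simp add: p_def)
        have per: "x (s + (q + p)) ?e = x (s + q) ?e" "x (s + (q + p)) ?e' = x (s + q) ?e'" if "q + p \<le> r" for q
        proof -
          have "x (s + (q + l ?e' * l ?e)) ?e = x (s + q) ?e"
            by (rule periodic_mult[of "l ?e" r "\<lambda>q. x (s + q) ?e"])
               (rule period[OF \<open>Q r\<close> _ eA(1)], assumption, use that in \<open>simp add: p_def mult.commute\<close>)
          then show "x (s + (q + p)) ?e = x (s + q) ?e" by (simp add: p_def mult.commute)
          have "x (s + (q + l ?e * l ?e')) ?e' = x (s + q) ?e'"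
            by (rule periodic_mult[of "l ?e'" r "\<lambda>q. x (s + q) ?e'"])
               (rule period[OF \<open>Q r\<close> _ eA(2)], assumption, use that in \<open>simp add: p_def\<close>)
          then show "x (s + (q + p)) ?e' = x (s + q) ?e'" by (simp add: p_def)
        qed
        have drift: "\<delta> v j j' (q + p) = \<delta> v j j' q + \<delta> v j j' p" if "q + p \<le> Suc r" for q
          using that
        proof (induction q)
          case (Suc q)
          then show ?case using per[of q] \<delta>_Suc[of v j j' q] \<delta>_Suc[of v j j' "q + p"] by simp
        qed (simp add: \<delta>_def)
        have "\<delta> v j j' (p + p) = \<delta> v j j' p + \<delta> v j j' p" using p2 by (intro drift) simp
        moreover have "\<delta> v j j' (p + p) \<in> {0, 1}" using p2 by (intro old) simp
        ultimately have "\<delta> v j j' p = 0" unfolding insert_iff empty_iff by presburger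
        then have "\<delta> v j j' (Suc r) = \<delta> v j j' (Suc r - p)" using drift[of "Suc r - p"] p2 by simp
        then show ?thesis using old[of "Suc r - p"] \<open>0 < p\<close> by simp
      qed
    qed
    then show "\<delta> v j j' q \<in> {0, 1}" using old[of q] q by (cases "q = Suc r") auto
  qed
  have "Q 0" unfolding Q_def using \<delta>_initial by auto
  then have "Q r" for r using extend by (induction r) auto
  then show ?thesis using \<pi>_bij step by blast
qed

text \<open>The factorial of \<open>card A\<close> is a common multiple of all return times of the
  matching.\<close>

lemma eventually_periodic:
  assumes "\<And>q i v e e'. s \<le> q \<Longrightarrow> q < s + block \<Longrightarrow> i \<le> 2 * card A + 1 \<Longrightarrow>
      v \<in> V \<Longrightarrow> e \<in> inn v \<Longrightarrow> e' \<in> inn v \<Longrightarrow> W q i e \<le> W q i e' + 1"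
  shows "\<exists>p>0. \<forall>r. \<forall>e\<in>A. x (s + (r + p)) e = x (s + r) e"
proof -
  have "\<exists>\<pi>. bij_betw \<pi> A A \<and> (\<forall>r. \<forall>e\<in>A. x (s + r) e = x (s + Suc r) (\<pi> e))"
    by (rule eventually_matched) (rule assms)
  then obtain \<pi> where \<pi>: "bij_betw \<pi> A A" "\<And>r e. e \<in> A \<Longrightarrow> x (s + r) e = x (s + Suc r) (\<pi> e)"
    by blast
  have iterate: "x (s + q) e = x (s + (q + n)) ((\<pi> ^^ n) e) \<and> (\<pi> ^^ n) e \<in> A" if "e \<in> A" for q n e
  proof (induction n)
    case (Suc n)
    then show ?case using \<pi>(2)[of "(\<pi> ^^ n) e" "q + n"] \<pi>(1) by (auto simp: bij_betw_def)
  qed (use that in simp)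
  have "x (s + (r + fact (card A))) e = x (s + r) e" if e: "e \<in> A" for r e
  proof -
    obtain l where l: "0 < l" "l \<le> card A" "(\<pi> ^^ l) e = e" using funpow_returns[OF fin_A \<pi>(1) e] by blast
    then have "l dvd fact (card A)" by (simp add: dvd_fact)
    then obtain n where n: "fact (card A) = n * l" by (metis dvd_def mult.commute)
    have "x (s + (q + l)) e = x (s + q) e" for q using iterate[OF e, of q l] l(3) by simp
    then show ?thesis unfolding n by (intro periodic_mult[of l "r + n * l" "\<lambda>q. x (s + q) e"]) auto
  qed
  then show ?thesis by (intro exI[of _ "fact (card A)"]) auto
qed

section \<open>The first block without energy drops\<close>

text \<open>After time \<open>T1\<close> the summed energy can fall by at most \<open>B\<close> up
  to the horizon. Being an integer, it must stay constant over one of the next \<open>B + 1\<close>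
  blocks.\<close>

lemma ex_periodic_start:
  assumes "0 < k"
  shows "\<exists>T. real T \<le> 22 * card A * D * ln ((2 * card A + 1) * k) + 1
        + ((2 * card A + 1) * (81 * card A * D\<^sup>2)) * block
      \<and> (\<exists>p>0. \<forall>r. \<forall>e\<in>A. x (T + (r + p)) e = x (T + r) e)"
proof -
  define I where "I = 2 * card A + 1"
  define B where "B = I * (81 * card A * D\<^sup>2)"
  define R where "R = 22 * card A * D * ln (I * k)"
  have "1 * 1 \<le> I * k" using assms unfolding I_def by (intro mult_mono) auto
  then have "1 \<le> real (I * k)" by linarith
  then have "0 \<le> R" unfolding R_def by (intro mult_nonneg_nonneg ln_ge_zero) auto
  define T1 where "T1 = nat \<lceil>R\<rceil>"
  have T1: "R \<le> real T1" "real T1 \<le> R + 1" unfolding T1_def using \<open>0 \<le> R\<close> by linarith+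
  define H where "H = T1 + Suc B * block"
  \<comment> \<open>One sum over all window lengths, so that a single block is free of drops for
    every length at once; length 0 is trivial.\<close>
  define \<Psi> where "\<Psi> s = (\<Sum>i\<in>{1..I}. \<Phi> i s)" for s
  have \<Psi>_antimono: "\<Psi> t \<le> \<Psi> s" if "s \<le> t" for s t
    unfolding \<Psi>_def using \<Phi>_antimono[OF that] by (intro sum_mono) auto
  have "\<Psi> T1 - \<Psi> H \<le> int B"
  proof -
    have "\<Psi> T1 - \<Psi> H = (\<Sum>i\<in>{1..I}. \<Phi> i T1 - \<Phi> i H)" by (simp add: \<Psi>_def sum_subtractf)
    also have "\<dots> \<le> (\<Sum>i\<in>{1..I}. 81 * int (card A) * (int D)\<^sup>2)"
    proof (intro sum_mono excess_le)
      fix i assume i: "i \<in> {1..I}"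
      then have "ln (real (i * k)) \<le> ln (real (I * k))"
        using assms by (subst ln_le_cancel_iff) (auto simp del: of_nat_mult)
      then have "22 * card A * D * ln (real (i * k)) \<le> R" unfolding R_def by (intro mult_left_mono) auto
      then show "22 * card A * D * ln (real (i * k)) \<le> real T1" using T1 by linarith
    qed (use assms in \<open>auto simp: H_def\<close>)
    also have "\<dots> = int B" by (simp add: B_def)
    finally show ?thesis .
  qed
  have "\<exists>j\<le>B. \<Psi> (T1 + Suc j * block) = \<Psi> (T1 + j * block)"
  proof (rule ccontr)
    assume no: "\<not> ?thesis"
    have "\<Psi> (T1 + Suc j * block) < \<Psi> (T1 + j * block)" if "j \<le> B" for j
      using no that \<Psi>_antimono[of "T1 + j * block" "T1 + Suc j * block"] by (auto simp: order_less_le)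
    then have "\<Psi> (T1 + j * block) \<le> \<Psi> T1 - int j" if "j \<le> Suc B" for j
      using that by (induction j) force+
    from this[of "Suc B"] \<open>\<Psi> T1 - \<Psi> H \<le> int B\<close> show False by (simp add: H_def)
  qed
  then obtain j where j: "j \<le> B" "\<Psi> (T1 + Suc j * block) = \<Psi> (T1 + j * block)" by blast
  define T where "T = T1 + j * block"
  have no_drop: "\<Phi> i (Suc q) = \<Phi> i q" if "T \<le> q" "q < T + block" "i \<in> {1..I}" for q i
  proof -
    have "\<Psi> q \<le> \<Psi> T" "\<Psi> (T + block) \<le> \<Psi> (Suc q)" using that by (auto intro: \<Psi>_antimono)
    moreover have "\<Psi> (T + block) = \<Psi> T" using j(2) by (simp add: T_def algebra_simps)
    ultimately have "\<Psi> q \<le> \<Psi> (Suc q)" by linarith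
    then have "(\<Sum>i\<in>{1..I}. \<Phi> i (Suc q)) = (\<Sum>i\<in>{1..I}. \<Phi> i q)"
      using \<Psi>_antimono[of q "Suc q"] by (simp add: \<Psi>_def)
    then show ?thesis using sum_mono_inv[of "\<lambda>i. \<Phi> i (Suc q)" "{1..I}" "\<lambda>i. \<Phi> i q" i] \<Phi>_Suc_le that(3) by blast
  qed
  have "\<exists>p>0. \<forall>r. \<forall>e\<in>A. x (T + (r + p)) e = x (T + r) e"
  proof (rule eventually_periodic)
    fix q i v e e'
    assume q: "T \<le> q" "q < T + block" and i: "i \<le> 2 * card A + 1" and v: "v \<in> V" "e \<in> inn v" "e' \<in> inn v"
    show "W q i e \<le> W q i e' + 1"
    proof (cases "i = 0")
      case False
      then have "\<Phi> i (Suc q) = \<Phi> i q" using no_drop[OF q] i by (simp add: I_def)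
      then show ?thesis using v by (rule inn_balanced_if_\<Phi>_eq)
    qed simp
  qed
  moreover have "real T \<le> R + 1 + B * block"
  proof -
    have "real (j * block) \<le> real (B * block)" using j(1) by (intro of_nat_mono mult_right_mono) auto
    then show ?thesis using T1(2) by (simp add: T_def)
  qed
  ultimately show ?thesis unfolding R_def B_def I_def by blast
qed

end

section \<open>Rotor-router systems\<close>

lemma cyclic_on_funpow_card:
  assumes "cyclic_on f X" "y \<in> X"
  shows "(f ^^ card X) y = y" and "bij_betw (\<lambda>j. (f ^^ j) y) {..<card X} X"
proof -
  have X: "X = orbit f y" "y \<in> orbit f y" using assms unfolding cyclic_on_alldef by auto
  define n where "n = funpow_dist1 f y y"
  have "X = (\<lambda>j. (f ^^ j) y) ` {..<n}"
    using orbit_conv_funpow_dist1[OF X(2)] X(1) by (simp add: n_def lessThan_atLeast0)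
  moreover have "inj_on (\<lambda>j. (f ^^ j) y) {..<n}"
    using inj_on_funpow_dist1[OF X(2)] by (simp add: n_def lessThan_atLeast0)
  ultimately have bij: "bij_betw (\<lambda>j. (f ^^ j) y) {..<n} X" by (simp add: bij_betw_def)
  then have "card X = n" using bij_betw_same_card by fastforce
  then show "(f ^^ card X) y = y" "bij_betw (\<lambda>j. (f ^^ j) y) {..<card X} X"
    using bij funpow_dist1_prop[OF X(2)] by (simp_all add: n_def)
qed

lemma cyclic_on_funpow_eq_iff:
  assumes "cyclic_on f X" "y \<in> X" "j < card X"
  shows "(f ^^ i) y = (f ^^ j) y \<longleftrightarrow> i mod card X = j"
proof -
  have "(f ^^ i) y = (f ^^ (i mod card X)) y" using cyclic_on_funpow_card(1)[OF assms(1,2)] by (simp add: funpow_mod_eq)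
  moreover have "i mod card X < card X" using assms(3) by (intro mod_less_divisor) simp
  ultimately show ?thesis
    using cyclic_on_funpow_card(2)[OF assms(1,2)] assms(3) by (auto simp: bij_betw_def dest: inj_onD)
qed

lemma card_less_add: "card {i. i < m + n \<and> P i} = card {i. i < m \<and> P i} + card {i. i < n \<and> P (m + i)}"
  for m n :: nat
proof -
  have "{i. i < m + n \<and> P i} = {i. i < m \<and> P i} \<union> (+) m ` {i. i < n \<and> P (m + i)}"
    by (auto simp: image_iff) (metis add_diff_inverse_nat nat_add_left_cancel_less)
  then show ?thesis by (simp only:) (subst card_Un_disjoint, auto simp: card_image)
qed

lemma card_less_mod_eq:
  assumes "j < d"
  shows "card {i. i < n \<and> i mod d = j} = (n + (d - Suc j)) div d"
proof (induction n)
  case 0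
  then show ?case using assms by simp
next
  case (Suc n)
  have "card {i. i < Suc n \<and> i mod d = j} = card {i. i < n \<and> i mod d = j} + (if n mod d = j then 1 else 0)"
  proof -
    have "{i. i < (1 :: nat) \<and> (n + i) mod d = j} = (if n mod d = j then {0} else {})" by auto
    then show ?thesis using card_less_add[of n 1 "\<lambda>i. i mod d = j"] by simp
  qed
  \<comment> \<open>The quotient grows at exactly those \<open>n\<close> that are counted, namely
    when the new numerator is a multiple of \<open>d\<close>.\<close>
  moreover have "(Suc n + (d - Suc j)) mod d = 0 \<longleftrightarrow> n mod d = j"
  proof -
    have "(Suc n + (d - Suc j)) mod d = (n mod d + (d - j)) mod d"
    proof -
      have "Suc n + (d - Suc j) = n + (d - j)" using assms by simp
      then show ?thesis by (simp only: mod_add_left_eq)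
    qed
    also have "\<dots> = 0 \<longleftrightarrow> n mod d = j"
    proof (cases "n mod d < j")
      case False
      then have "n mod d + (d - j) = (n mod d - j) + d" using assms by simp
      moreover have "n mod d - j < d" using assms mod_less_divisor[of d n] by linarith
      ultimately have "(n mod d + (d - j)) mod d = n mod d - j" by (simp only: mod_add_self2 mod_less)
      then show ?thesis using False by simp
    qed (use assms in auto)
    finally show ?thesis .
  qed
  ultimately show ?case using Suc by (simp add: div_Suc)
qed

section \<open>Loads of a rotor-router run\<close>

locale rotor_router_system = pair_graph G for G :: "'a pair_pre_digraph" +
  fixes nxt :: "'a \<times> 'a \<Rightarrow> 'a \<times> 'a" and S\<^sub>0 :: "'a rr_state"
  assumes conn: "Digraph_Component.connected (with_proj G)"
    and rotor: "rotor G nxt" and init: "rr_state_on G S\<^sub>0"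
begin

abbreviation ptr where "ptr t \<equiv> pointer (rr_run G nxt S\<^sub>0 t)"
abbreviation tok where "tok t \<equiv> tokens (rr_run G nxt S\<^sub>0 t)"

definition load :: "nat \<Rightarrow> 'a \<times> 'a \<Rightarrow> int" where
  "load t e = int (card {i. i < tok t (fst e) \<and> (nxt ^^ i) (ptr t (fst e)) = e})"

definition outs :: "'a \<Rightarrow> ('a \<times> 'a) set" where "outs v = {e \<in> parcs G. fst e = v}"

lemma out_arcs_eq: "out_arcs (with_proj G) v = outs v"
  by (auto simp: outs_def out_arcs_def)

lemma cyclic_outs: "v \<in> pverts G \<Longrightarrow> cyclic_on nxt (outs v)"
  using rotor by (simp add: rotor_def out_arcs_eq)

lemma fin_outs [simp]: "finite (outs v)"
  using pair_finite_arcs by (simp add: outs_def)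

lemma ptr_Suc: "ptr (Suc t) v = (nxt ^^ tok t v) (ptr t v)"
  by (simp add: rr_run_def rr_step_def)

lemma tok_Suc: "tok (Suc t) u = (\<Sum>v\<in>pverts G. card {i. i < tok t v \<and> snd ((nxt ^^ i) (ptr t v)) = u})"
  by (simp add: rr_run_def rr_step_def)

lemma ptr_outs: "v \<in> pverts G \<Longrightarrow> ptr t v \<in> outs v"
proof (induction t)
  case 0
  then show ?case using init by (simp add: rr_run_def rr_state_on_def out_arcs_eq)
qed (simp add: ptr_Suc cyclic_on_funpow_in cyclic_outs)

lemma funpow_ptr_outs: "v \<in> pverts G \<Longrightarrow> (nxt ^^ i) (ptr t v) \<in> outs v"
  using ptr_outs by (simp add: cyclic_on_funpow_in cyclic_outs)

lemma tok_outside: "v \<notin> pverts G \<Longrightarrow> tok t v = 0"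
proof (cases t)
  case 0
  then show "v \<notin> pverts G \<Longrightarrow> tok t v = 0" using init by (simp add: rr_run_def rr_state_on_def)
next
  case (Suc n)
  assume v: "v \<notin> pverts G"
  have "snd ((nxt ^^ i) (ptr n u)) \<noteq> v" if "u \<in> pverts G" for u i
    using funpow_ptr_outs[OF that, of i n] arc_snd_in_verts v by (auto simp: outs_def)
  then show ?thesis by (simp add: Suc tok_Suc)
qed

lemma load_out: "v \<in> pverts G \<Longrightarrow> (\<Sum>e\<in>outs v. load t e) = int (tok t v)"
proof -
  assume v: "v \<in> pverts G"
  have "(\<Sum>e\<in>outs v. load t e) = (\<Sum>e\<in>outs v. \<Sum>i\<in>{i \<in> {..<tok t v}. (nxt ^^ i) (ptr t v) = e}. 1)"
    by (intro sum.cong refl) (auto simp: load_def outs_def)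
  also have "\<dots> = (\<Sum>i\<in>{..<tok t v}. 1)"
    using funpow_ptr_outs[OF v] by (intro sum.group) auto
  finally show ?thesis by simp
qed

lemma load_in: "(\<Sum>e | e \<in> parcs G \<and> snd e = u. load t e) = int (tok (Suc t) u)"
proof -
  have "int (card {i. i < tok t v \<and> snd ((nxt ^^ i) (ptr t v)) = u})
      = (if (v, u) \<in> parcs G then load t (v, u) else 0)" if "v \<in> pverts G" for v
  proof -
    have "snd ((nxt ^^ i) (ptr t v)) = u \<longleftrightarrow> (nxt ^^ i) (ptr t v) = (v, u)" for i
      using funpow_ptr_outs[OF that, of i t] by (auto simp: outs_def prod_eq_iff)
    moreover have "(nxt ^^ i) (ptr t v) \<noteq> (v, u)" if "(v, u) \<notin> parcs G" for i
      using funpow_ptr_outs[OF \<open>v \<in> pverts G\<close>, of i t] that by (auto simp: outs_def)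
    ultimately show ?thesis by (simp add: load_def)
  qed
  then have "int (tok (Suc t) u) = (\<Sum>v\<in>pverts G. if (v, u) \<in> parcs G then load t (v, u) else 0)"
    by (simp add: tok_Suc)
  also have "\<dots> = (\<Sum>v\<in>{v \<in> pverts G. (v, u) \<in> parcs G}. load t (v, u))"
    using pair_finite_verts by (simp add: sum.inter_filter)
  also have "\<dots> = (\<Sum>e | e \<in> parcs G \<and> snd e = u. load t e)"
    by (rule sum.reindex_bij_witness[of _ fst "\<lambda>v. (v, u)"]) (auto dest: in_arcsD1)
  finally show ?thesis by simp
qed

text \<open>Each step resumes the rotor where the previous one left it, so several steps act on a
  vertex like one step sending all their tokens.\<close>

lemma window:
  assumes "v \<in> pverts G"
  shows "ptr (s + i) v = (nxt ^^ (\<Sum>q<i. tok (s + q) v)) (ptr s v)"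
    and "e \<in> outs v \<Longrightarrow> (\<Sum>q<i. load (s + q) e)
      = int (card {j. j < (\<Sum>q<i. tok (s + q) v) \<and> (nxt ^^ j) (ptr s v) = e})"
proof -
  show *: "ptr (s + i) v = (nxt ^^ (\<Sum>q<i. tok (s + q) v)) (ptr s v)" for i
    by (induction i) (simp_all add: ptr_Suc funpow_add add.commute)
  show "(\<Sum>q<i. load (s + q) e) = int (card {j. j < (\<Sum>q<i. tok (s + q) v) \<and> (nxt ^^ j) (ptr s v) = e})"
    if "e \<in> outs v"
  proof (induction i)
    case (Suc i)
    define N where "N = (\<Sum>q<i. tok (s + q) v)"
    have "(nxt ^^ j) (ptr (s + i) v) = (nxt ^^ (N + j)) (ptr s v)" for j
      unfolding * by (subst add.commute) (simp add: N_def funpow_add)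
    then have "load (s + i) e = int (card {j. j < tok (s + i) v \<and> (nxt ^^ (N + j)) (ptr s v) = e})"
      using that by (simp add: load_def outs_def)
    then show ?case using Suc by (simp add: N_def card_less_add)
  qed simp
qed

lemma load_total: "(\<Sum>e\<in>parcs G. load t e) = int (num_tokens G S\<^sub>0)"
proof -
  have outs: "(\<Sum>e\<in>parcs G. load t e) = (\<Sum>v\<in>pverts G. int (tok t v))" for t
  proof -
    have "(\<Sum>e\<in>parcs G. load t e) = (\<Sum>v\<in>pverts G. \<Sum>e\<in>outs v. load t e)"
      unfolding outs_def using pair_finite_verts pair_finite_arcs
      by (intro sum.group[symmetric]) (auto dest: in_arcsD1)
    also have "\<dots> = (\<Sum>v\<in>pverts G. int (tok t v))" by (intro sum.cong refl load_out)
    finally show ?thesis .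
  qed
  have "(\<Sum>v\<in>pverts G. int (tok (Suc t) v)) = (\<Sum>e\<in>parcs G. load t e)" for t
    unfolding load_in[symmetric] using pair_finite_verts pair_finite_arcs
    by (intro sum.group) (auto dest: in_arcsD2)
  then have "(\<Sum>e\<in>parcs G. load t e) = (\<Sum>v\<in>pverts G. int (tok 0 v))"
    by (induction t) (simp_all add: outs)
  then show ?thesis by (simp add: rr_run_def num_tokens_def)
qed

text \<open>List the arcs from the pointer at time \<open>s\<close> on. If \<open>N\<close> tokens
  leave in the window, position \<open>j\<close> receives \<open>(N + (d - Suc j)) div d\<close> of
  them; this decreases in \<open>j\<close>, and the numerators differ by less than
  \<open>d\<close>.\<close>

lemma load_round_robin:
  assumes v: "v \<in> pverts G"
  shows "\<exists>f. bij_betw f {..<card (outs v)} (outs v) \<and>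
      (\<forall>i j j'. j < j' \<longrightarrow> j' < card (outs v) \<longrightarrow>
        (\<Sum>q<i. load (s + q) (f j')) \<le> (\<Sum>q<i. load (s + q) (f j)) \<and>
        (\<Sum>q<i. load (s + q) (f j)) \<le> (\<Sum>q<i. load (s + q) (f j')) + 1)"
proof -
  define f where "f j = (nxt ^^ j) (ptr s v)" for j
  define d where "d = card (outs v)"
  have bij: "bij_betw f {..<d} (outs v)"
    unfolding f_def d_def by (rule cyclic_on_funpow_card[OF cyclic_outs[OF v] ptr_outs[OF v]])
  have count: "(\<Sum>q<i. load (s + q) (f j)) = int (((\<Sum>q<i. tok (s + q) v) + (d - Suc j)) div d)"
    if "j < d" for i j
  proof -
    have "f j \<in> outs v" using funpow_ptr_outs[OF v] by (simp add: f_def)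
    from window(2)[OF v this, of s i] show ?thesis
      using cyclic_on_funpow_eq_iff[OF cyclic_outs[OF v] ptr_outs[OF v], of j] card_less_mod_eq[OF that] that
      by (simp add: f_def d_def)
  qed
  have mono: "(N + (d - Suc j')) div d \<le> (N + (d - Suc j)) div d
      \<and> (N + (d - Suc j)) div d \<le> (N + (d - Suc j')) div d + 1" if "j < j'" "j' < d" for N j j'
  proof
    show "(N + (d - Suc j')) div d \<le> (N + (d - Suc j)) div d" using that by (intro div_le_mono) auto
    have "(N + (d - Suc j)) div d \<le> (N + (d - Suc j') + d) div d" using that by (intro div_le_mono) auto
    also have "\<dots> = (N + (d - Suc j')) div d + 1" using that by (intro div_add_self2) simp
    finally show "(N + (d - Suc j)) div d \<le> (N + (d - Suc j')) div d + 1" .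
  qed
  have "\<forall>i j j'. j < j' \<longrightarrow> j' < d \<longrightarrow>
        (\<Sum>q<i. load (s + q) (f j')) \<le> (\<Sum>q<i. load (s + q) (f j)) \<and>
        (\<Sum>q<i. load (s + q) (f j)) \<le> (\<Sum>q<i. load (s + q) (f j')) + 1"
  proof (intro allI impI)
    fix i j j' assume "j < j'" "j' < d"
    then have "j < d" by simp
    from mono[OF \<open>j < j'\<close> \<open>j' < d\<close>, of "\<Sum>q<i. tok (s + q) v"]
    show "(\<Sum>q<i. load (s + q) (f j')) \<le> (\<Sum>q<i. load (s + q) (f j)) \<and>
        (\<Sum>q<i. load (s + q) (f j)) \<le> (\<Sum>q<i. load (s + q) (f j')) + 1"
      unfolding count[OF \<open>j < d\<close>] count[OF \<open>j' < d\<close>] by linarith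
  qed
  then show ?thesis using bij unfolding d_def by blast
qed

section \<open>Walks and the diameter\<close>

lemma relpow_of_pcas: "pcas u p v \<Longrightarrow> set p \<subseteq> R \<Longrightarrow> (u, v) \<in> R ^^ length p"
  by (induction p arbitrary: u) (auto intro: relpow_Suc_I2 simp del: relpow.simps(2))

lemma graph_dist_walk:
  assumes "u \<in> pverts G" "v \<in> pverts G"
  shows "\<exists>p. awalk u p v \<and> length p = graph_dist G u v"
proof -
  have "strongly_connected (with_proj G)"
    by (rule symmetric_connected_imp_strongly_connected[OF pair_sym_arcs conn])
  then have "u \<rightarrow>\<^sup>*\<^bsub>with_proj G\<^esub> v" using assms by (simp add: strongly_connected_def)
  then obtain p where "awalk u p v" unfolding reachable_awalk ..
  then have "\<exists>q. awalk u q v \<and> length q = length p" by blast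
  then show ?thesis unfolding graph_dist_def by (rule LeastI[of "\<lambda>n. \<exists>q. awalk u q v \<and> length q = n"])
qed

lemma graph_dist_le_diameter:
  "u \<in> pverts G \<Longrightarrow> v \<in> pverts G \<Longrightarrow> graph_dist G u v \<le> diameter G"
  unfolding diameter_def using pair_finite_verts by (intro Max_ge) (auto intro: rev_image_eqI[of "(u, v)"])

text \<open>A connected graph has a vertex, and its pointer is an arc.\<close>

lemma ex_arc: "\<exists>e. e \<in> parcs G"
proof -
  have "pverts G \<noteq> {}" using conn by (auto simp: connected_def strongly_connected_def)
  then obtain v where "v \<in> pverts G" by blast
  from ptr_outs[OF this, of 0] show ?thesis unfolding outs_def by blast
qed

lemma diameter_pos: "0 < diameter G"
proof -
  obtain u v where uv: "(u, v) \<in> parcs G" using ex_arc by auto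
  then have V: "u \<in> pverts G" "v \<in> pverts G" "u \<noteq> v" using in_arcsD1 in_arcsD2 pair_no_loops by fastforce+
  then obtain p where "awalk u p v" "length p = graph_dist G u v" using graph_dist_walk by blast
  then have "0 < graph_dist G u v" using V by (cases p) (auto dest: awalk_empty_ends)
  then show ?thesis using graph_dist_le_diameter[OF V(1,2)] by simp
qed

sublocale token_loads "pverts G" "parcs G" "diameter G" "num_tokens G S\<^sub>0" load
proof
  show "finite (pverts G)" by (rule pair_finite_verts)
  show "parcs G \<subseteq> pverts G \<times> pverts G" using in_arcsD1 in_arcsD2 by auto
  show "sym (parcs G)" using pair_sym_arcs by (simp add: symmetric_def)
  show "0 < diameter G" by (rule diameter_pos)
  show "\<exists>n\<le>diameter G. (u, v) \<in> parcs G ^^ n" if "u \<in> pverts G" "v \<in> pverts G" for u v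
  proof -
    from graph_dist_walk[OF that] obtain p where "awalk u p v" "length p = graph_dist G u v" by blast
    then show ?thesis using graph_dist_le_diameter[OF that] relpow_of_pcas[of u p v "parcs G"] by (auto simp: awalk_def)
  qed
  show "0 \<le> load t e" for t e by (simp add: load_def)
  show "(\<Sum>e | e \<in> parcs G \<and> fst e = v. load (Suc t) e) = (\<Sum>e | e \<in> parcs G \<and> snd e = v. load t e)"
    if "v \<in> pverts G" for v t
    unfolding load_in using load_out[OF that] by (simp add: outs_def)
  show "(\<Sum>e\<in>parcs G. load t e) = int (num_tokens G S\<^sub>0)" for t by (rule load_total)
qed (use load_round_robin in \<open>simp add: outs_def\<close>)

text \<open>Token counts recur after \<open>p\<close> steps, while pointers may have advanced by a
  fixed amount. After \<open>fact (card (parcs G))\<close> periods this advance is a multiple of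
  every degree, so the pointers recur too.\<close>

lemma stable_if_loads_periodic:
  assumes "0 < p" and per: "\<And>r e. e \<in> parcs G \<Longrightarrow> load (T + (r + p)) e = load (T + r) e"
  shows "stable_at G nxt S\<^sub>0 T"
proof -
  have tok_per: "tok (T + (r + p)) v = tok (T + r) v" for r v
  proof (cases "v \<in> pverts G")
    case True
    have "int (tok (T + (r + p)) v) = int (tok (T + r) v)"
      unfolding load_out[OF True, symmetric] using per by (intro sum.cong refl) (auto simp: outs_def)
    then show ?thesis by simp
  qed (simp add: tok_outside)
  then have tok_mult: "tok (T + (r + n * p)) v = tok (T + r) v" for r n v
    by (intro periodic_mult[of p "r + n * p" "\<lambda>q. tok (T + q) v"]) auto
  define N where "N n v = (\<Sum>q<n * p. tok (T + q) v)" for n v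
  have N: "N n v = n * (\<Sum>q<p. tok (T + q) v)" for n v
  proof (induction n)
    case (Suc n)
    have "(\<Sum>q<n * p + l. tok (T + q) v) = N n v + (\<Sum>q<l. tok (T + (q + n * p)) v)" for l
      by (induction l) (simp_all add: N_def add.commute)
    from this[of p] have "N (Suc n) v = N n v + (\<Sum>q<p. tok (T + (q + n * p)) v)"
      by (simp add: N_def add.commute)
    then show ?case using Suc by (simp add: tok_mult)
  qed (simp add: N_def)
  define M where "M = fact (card (parcs G)) * p"
  have "ptr (T + M) v = ptr T v" for v
  proof (cases "v \<in> pverts G")
    case True
    have "outs v \<noteq> {}" using ptr_outs[OF True] by blast
    moreover have "card (outs v) \<le> card (parcs G)" unfolding outs_def by (intro card_mono pair_finite_arcs) auto
    ultimately have "card (outs v) dvd fact (card (parcs G))"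
      by (intro dvd_fact) (auto simp: Suc_le_eq card_gt_0_iff)
    then have "N (fact (card (parcs G))) v mod card (outs v) = 0" by (simp add: N)
    then have "(nxt ^^ N (fact (card (parcs G))) v) (ptr T v) = ptr T v"
      using cyclic_on_funpow_card(1)[OF cyclic_outs[OF True] ptr_outs[OF True, of T]]
      by (metis funpow_mod_eq funpow_0)
    then show ?thesis using window(1)[OF True, of T M] by (simp add: M_def N_def)
  next
    case False
    then have "ptr (T + n) v = ptr T v" for n by (induction n) (simp_all add: ptr_Suc tok_outside)
    then show ?thesis .
  qed
  moreover have "tok (T + M) v = tok T v" for v
    using tok_mult[of 0 "fact (card (parcs G))" v] by (simp add: M_def)
  ultimately have "rr_run G nxt S\<^sub>0 (T + M) = rr_run G nxt S\<^sub>0 T"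
    by (intro rr_state.equality) auto
  moreover have "0 < M" using \<open>0 < p\<close> by (simp add: M_def)
  ultimately show ?thesis unfolding stable_at_def by (intro exI[of _ "T + M"]) auto
qed

lemma stable_if_no_tokens: "num_tokens G S\<^sub>0 = 0 \<Longrightarrow> stable_at G nxt S\<^sub>0 0"
proof -
  assume "num_tokens G S\<^sub>0 = 0"
  then have "(\<Sum>e\<in>parcs G. load t e) = 0" for t using load_total[of t] by simp
  then have "load t e = 0" if "e \<in> parcs G" for t e
    using sum_nonneg_eq_0_iff[OF pair_finite_arcs, of "load t"] that by (auto simp: load_def)
  then show ?thesis by (intro stable_if_loads_periodic[of 1]) auto
qed

section \<open>Arcs against edges, and the explicit constant\<close>

lemma card_parcs_le: "card (parcs G) \<le> 2 * card (edges G)"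
proof -
  have "finite (edges G)" unfolding edges_def using pair_finite_arcs by simp
  have "parcs G \<subseteq> (\<Union>E\<in>edges G. {(u, v). {u, v} = E})" by (auto simp: edges_def)
  moreover have le2: "finite {(u, v). {u, v} = E} \<and> card {(u, v). {u, v} = E} \<le> 2" if "E \<in> edges G" for E
  proof -
    obtain a b where "E = {a, b}" using \<open>E \<in> edges G\<close> by (auto simp: edges_def)
    then have sub: "{(u, v). {u, v} = E} \<subseteq> {(a, b), (b, a)}" by (auto simp: doubleton_eq_iff)
    have "card {(u, v). {u, v} = E} \<le> card {(a, b), (b, a)}" by (rule card_mono[OF _ sub]) simp
    also have "\<dots> \<le> 2" by (cases "a = b") simp_all
    finally have "card {(u, v). {u, v} = E} \<le> 2" .
    moreover have "finite {(u, v). {u, v} = E}" using sub by (rule finite_subset) simp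
    ultimately show ?thesis by (rule conjI[rotated])
  qed
  ultimately have "card (parcs G) \<le> card (\<Union>E\<in>edges G. {(u, v). {u, v} = E})"
    using \<open>finite (edges G)\<close> by (intro card_mono) auto
  also have "\<dots> \<le> (\<Sum>E\<in>edges G. card {(u, v). {u, v} = E})" by (rule card_UN_le[OF \<open>finite (edges G)\<close>])
  also have "\<dots> \<le> (\<Sum>E\<in>edges G. 2)" using le2 by (intro sum_mono) blast
  finally show ?thesis by simp
qed

lemma stabilization_time:
  defines "m \<equiv> card (edges G)" and "D \<equiv> diameter G" and "k \<equiv> num_tokens G S\<^sub>0"
  shows "\<exists>T. real T \<le> 20000 * (real m ^ 4 * real D ^ 2 + real m * real D * ln (real k)) \<and> stable_at G nxt S\<^sub>0 T"
proof (cases "k = 0")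
  case True
  \<comment> \<open>Since \<open>ln 0 = 0\<close>, the bound is nonnegative here and time 0
    qualifies.\<close>
  then have "real 0 \<le> 20000 * (real m ^ 4 * real D ^ 2 + real m * real D * ln (real k))" by simp
  then show ?thesis using stable_if_no_tokens True unfolding k_def by blast
next
  case False
  define a where "a = card (parcs G)"
  have a: "1 \<le> real a" "real a \<le> 2 * real m"
    using card_A_pos False card_parcs_le by (simp_all add: a_def m_def k_def Suc_leI)
  have D: "1 \<le> real D" using diameter_pos by (simp add: D_def Suc_leI)
  have "1 \<le> real m" using a by (cases m) auto
  obtain T where T: "real T \<le> 22 * a * D * ln ((2 * a + 1) * k) + 1 + ((2 * a + 1) * (81 * a * D\<^sup>2)) * block"
    and "\<exists>p>0. \<forall>r. \<forall>e\<in>parcs G. load (T + (r + p)) e = load (T + r) e"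
    using ex_periodic_start False unfolding k_def a_def D_def by auto
  then have stable: "stable_at G nxt S\<^sub>0 T" using stable_if_loads_periodic by blast
  \<comment> \<open>The logarithm of the window length is at most \<open>2 * a\<close>, hence at
    most \<open>4 * m\<close>, and goes into the polynomial term.\<close>
  have "22 * a * D * ln ((2 * a + 1) * k) \<le> 22 * (2 * m) * D * (4 * m + ln k)"
  proof (intro mult_mono)
    have "ln (1 + 2 * real a) \<le> 2 * real a" by (rule ln_add_one_self_le_self) simp
    moreover have "ln (real ((2 * a + 1) * k)) = ln (1 + 2 * real a) + ln (real k)"
      using False by (simp add: ln_mult_pos[symmetric] algebra_simps)
    ultimately show "ln (real ((2 * a + 1) * k)) \<le> real (4 * m) + ln (real k)" using a by simp
    show "0 \<le> ln (real ((2 * a + 1) * k))" using False by (intro ln_ge_zero) (simp add: Suc_leI flip: of_nat_mult)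
    show "real (22 * a * D) \<le> real (22 * (2 * m) * D)"
      using a(2) by (intro of_nat_mono mult_right_mono mult_left_mono) auto
  qed auto
  also have "\<dots> = 176 * (real m ^ 2 * real D) + 44 * (real m * real D * ln k)"
    by (simp add: power2_eq_square algebra_simps)
  also have "real m ^ 2 * real D \<le> real m ^ 4 * real D ^ 2"
    using \<open>1 \<le> real m\<close> D by (intro mult_mono power_increasing) (auto simp: power2_eq_square)
  finally have 1: "22 * a * D * ln ((2 * a + 1) * k) \<le> 176 * (real m ^ 4 * real D ^ 2) + 44 * (real m * real D * ln k)"
    by linarith
  have "1 * 1 \<le> real m ^ 4 * real D ^ 2" using \<open>1 \<le> real m\<close> D by (intro mult_mono one_le_power) auto
  then have 2: "1 \<le> real m ^ 4 * real D ^ 2" by simp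
  have "real a \<le> real a ^ 2" using a by (simp add: power2_eq_square)
  moreover have "(real a)\<^sup>2 \<le> (2 * real m)\<^sup>2" using a by (intro power_mono) auto
  moreover have "real block = 2 * (real a)\<^sup>2 + 2 * real a + 1" by (simp add: block_def a_def)
  ultimately have block_le: "real block \<le> 5 * (2 * real m) ^ 2" using a(1) by linarith
  \<comment> \<open>With \<open>a\<close> at most \<open>2 * m\<close> the factor
    \<open>2 * a + 1\<close> is at most \<open>6 * m\<close>; the constants multiply to 19440, and
    adding 176 and 1 stays below 20000.\<close>
  have "(2 * real a + 1) * (81 * real a * (real D)\<^sup>2) * real block
      \<le> (6 * real m) * (81 * (2 * real m) * (real D)\<^sup>2) * (5 * (2 * real m) ^ 2)"
    using a block_le \<open>1 \<le> real m\<close> by (intro mult_mono) auto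
  also have "\<dots> = 19440 * (real m ^ 4 * real D ^ 2)"
    by (simp add: power2_eq_square power4_eq_xxxx)
  finally have 3: "(2 * real a + 1) * (81 * real a * (real D)\<^sup>2) * real block \<le> 19440 * (real m ^ 4 * real D ^ 2)" .
  have "0 \<le> real m * real D * ln k" using False by (intro mult_nonneg_nonneg ln_ge_zero) auto
  then have "real T \<le> 20000 * (real m ^ 4 * real D ^ 2 + real m * real D * ln (real k))"
    using T 1 2 3 by (simp add: algebra_simps)
  then show ?thesis using stable by blast
qed

end

theorem theorem6:
  shows "\<exists>C :: real. \<forall>(G :: 'a pair_pre_digraph) nxt S\<^sub>0 m D k.
    pair_graph G \<and> Digraph_Component.connected (with_proj G) \<and>
    rotor G nxt \<and> rr_state_on G S\<^sub>0 \<and>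
    m = card (edges G) \<and> D = diameter G \<and> k = num_tokens G S\<^sub>0 \<longrightarrow>
    (\<exists>T :: nat. real T \<le> C * (real m ^ 4 * real D ^ 2 + real m * real D * ln (real k)) \<and>
      stable_at G nxt S\<^sub>0 T)"
proof (rule exI[of _ 20000], intro allI impI)
  fix G :: "'a pair_pre_digraph" and nxt S\<^sub>0 m D k
  assume *: "pair_graph G \<and> Digraph_Component.connected (with_proj G) \<and>
    rotor G nxt \<and> rr_state_on G S\<^sub>0 \<and>
    m = card (edges G) \<and> D = diameter G \<and> k = num_tokens G S\<^sub>0"
  then interpret rotor_router_system G nxt S\<^sub>0
    by (intro rotor_router_system.intro rotor_router_system_axioms.intro) auto
  show "\<exists>T :: nat. real T \<le> 20000 * (real m ^ 4 * real D ^ 2 + real m * real D * ln (real k)) \<and>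
      stable_at G nxt S\<^sub>0 T"
    using stabilization_time * by simp
qed

end
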